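(* In the regression setting and with the notation given in the context, let $\delta_1,\delta_2$ be two regression procedures with estimators $\widehat f_{n,1},\widehat f_{n,2}$ ($n\ge 1$) of $f$, and suppose that $\widehat f_{n,1}$ converges exactly at rate $\{p_n\}$ in probability and $\widehat f_{n,2}$ converges exactly at rate $\{q_n\}$ in probability, both under the $L_2$ loss. Assume that the observations $(X_i,Y_i)$ are independent and identically distributed, and: (0) there is a constant $\overline\sigma^2>0$ such that $E(\varepsilon_i^2\mid X_i)\le\overline\sigma^2$ almost surely for all $i\ge1$; (1) there is a sequence of positive numbers $\{A_n\}$ such that $\|f-\widehat f_{n,j}\|_\infty=O_p(A_n)$ for $j=1,2$; (2) under the $L_2$ loss, either $\delta_1$ is asymptotically better than $\delta_2$, or $\delta_2$ is asymptotically better than $\delta_1$; (3) there is a sequence of positive numbers $\{M_n\}$ such that $\|f-\widehat f_{n,j}\|_4/\|f-\widehat f_{n,j}\|_2=O_p(M_n)$ for $j=1,2$. Suppose the data splitting $n=n_1+n_2$ (with $n_1=n_1(n)$, $n_2=n_2(n)$) satisfies, as $n\to\infty$: (a) $n_1\to\infty$ and $n_2\to\infty$; (b) $n_2M_{n_1}^{-4}\to\infty$; (c) $\sqrt{n_2}\,\max(p_{n_1},q_{n_1})/(1+A_{n_1})\to\infty$. Then the voting-based cross validation (CV-v) over all $n!$ permutations of the observations is consistent in selection: the probability that it selects the asymptotically better of $\delta_1,\delta_2$ (under the $L_2$ loss) tends to $1$ as $n\to\infty$.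
   Context: Setting: $Y_i=f(X_i)+\varepsilon_i$, $i\ge 1$, where the $X_i$ are i.i.d. with (unknown) distribution $P_X$ on a Borel set $\mathcal X\subset\mathbb R^d$, $d\ge1$, $f$ is the true regression function, and $E(\varepsilon_i\mid X_i)=0$, $E(\varepsilon_i^2\mid X_i)<\infty$ almost surely. A regression procedure $\delta_j$ produces, from a sample $(X_i,Y_i)_{i=1}^n$ of any size $n$, an estimator $\widehat f_{n,j}$ of $f$ (a function on $\mathcal X$). Norms: $\|g\|_q=\left(\int|g(x)|^qP_X(dx)\right)^{1/q}$ for $1\le q<\infty$, and $\|g\|_\infty=\operatorname{ess\,sup}|g|$ (with respect to $P_X$). The $L_2$ loss is $L(f,\widehat f)=\|f-\widehat f\|_2$. Asymptotically better: under a loss $L$, a procedure with estimators $\widehat\theta_{n,1}$ is asymptotically better than one with estimators $\widehat\theta_{n,2}$ if for every $0<\epsilon<1$ there is a constant $c_\epsilon>0$ such that for all large enough $n$, $P\big(L(\theta,\widehat\theta_{n,2})\ge(1+c_\epsilon)L(\theta,\widehat\theta_{n,1})\big)\ge1-\epsilon$. Exact rate: for a sequence $\{a_n\}$ of positive numbers approaching zero, $\{\widehat\theta_n\}$ converges exactly at rate $\{a_n\}$ in probability under $L$ if $L(\theta,\widehat\theta_n)=O_p(a_n)$ and for every $0<\epsilon<1$ there is $c_\epsilon>0$ such that $P(L(\theta,\widehat\theta_n)\ge c_\epsilon a_n)\ge1-\epsilon$ for all large enough $n$. CV-v procedure: let $\Pi$ be the set of all $n!$ permutations of the $n$ observations.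 For $\pi\in\Pi$, reorder the observations according to $\pi$, apply $\delta_1,\delta_2$ to the first $n_1$ reordered observations to get estimators $\widehat f_{n_1,1},\widehat f_{n_1,2}$, and let $\mathrm{CV}_\pi(\widehat f_{n_1,j})$ be the sum of $(Y-\widehat f_{n_1,j}(X))^2$ over the remaining $n_2=n-n_1$ reordered observations $(X,Y)$, $j=1,2$. Let $\tau_\pi=1$ if $\mathrm{CV}_\pi(\widehat f_{n_1,1})\le\mathrm{CV}_\pi(\widehat f_{n_1,2})$ and $\tau_\pi=0$ otherwise. Select $\delta_1$ if $\sum_{\pi\in\Pi}\tau_\pi\ge n!/2$, and select $\delta_2$ otherwise. *)

theory Defs
  imports "HOL-Probability.Probability" "HOL-Combinatorics.Permutations"
begin

text \<open>
  A sample of size \<open>n\<close> is a function on the index set \<open>{1..n}\<close> (an element of a \<open>PiM\<close> space,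
  hence \<open>undefined\<close> outside), and an estimator is a function on \<open>\<X>\<close> given as a total function
  whose values outside \<open>\<X>\<close> are never used. Norms and losses are \<open>ennreal\<close>-valued, as they may
  be infinite.
\<close>

definition Lq_norm :: "'a measure \<Rightarrow> real \<Rightarrow> ('a \<Rightarrow> real) \<Rightarrow> ennreal" where
  "Lq_norm P q g =
     (let I = (\<integral>\<^sup>+x. ennreal (\<bar>g x\<bar> powr q) \<partial>P)
      in if I = \<infinity> then \<infinity> else ennreal (enn2real I powr (1 / q)))"

definition Linf_norm :: "'a measure \<Rightarrow> ('a \<Rightarrow> real) \<Rightarrow> ennreal" where
  "Linf_norm P g = esssup P (\<lambda>x. ennreal \<bar>g x\<bar>)"

definition L2_loss :: "'a measure \<Rightarrow> ('a \<Rightarrow> real) \<Rightarrow> ('a \<Rightarrow> real) \<Rightarrow> ennreal" where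
  "L2_loss P g h = Lq_norm P 2 (\<lambda>x. g x - h x)"

definition obs_space :: "(real ^ 'd) set \<Rightarrow> ((real ^ 'd) \<times> real) measure" where
  "obs_space \<X> = restrict_space borel \<X> \<Otimes>\<^sub>M borel"

text \<open>
  The conditional second moments of the errors are assumed to be finite, so \<open>real_cond_exp\<close>,
  the difference of the conditional expectations of the positive and the negative part, is a
  difference of two almost surely finite quantities even before the errors are known to be
  integrable.
\<close>

locale regression_setting = prob_space \<Omega> for \<Omega> :: "'w measure" +
  fixes \<X> :: "(real ^ 'd) set"
    and P\<^sub>X :: "(real ^ 'd) measure"
    and f :: "real ^ 'd \<Rightarrow> real"
    and X :: "nat \<Rightarrow> 'w \<Rightarrow> real ^ 'd"
    and Y \<epsilon> :: "nat \<Rightarrow> 'w \<Rightarrow> real"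
  assumes domain_borel: "\<X> \<in> sets borel"
    and regression_function_measurable: "f \<in> borel_measurable (restrict_space borel \<X>)"
    and X_indep: "indep_vars (\<lambda>_. restrict_space borel \<X>) X {1..}"
    and X_distr: "i \<ge> 1 \<Longrightarrow> distr \<Omega> (restrict_space borel \<X>) (X i) = P\<^sub>X"
    and error_measurable: "i \<ge> 1 \<Longrightarrow> random_variable borel (\<epsilon> i)"
    and model: "i \<ge> 1 \<Longrightarrow> w \<in> space \<Omega> \<Longrightarrow> Y i w = f (X i w) + \<epsilon> i w"
    and error_mean: "i \<ge> 1 \<Longrightarrow> AE w in \<Omega>.
        real_cond_exp \<Omega> (vimage_algebra (space \<Omega>) (X i) (restrict_space borel \<X>)) (\<epsilon> i) w = 0"
    and error_variance: "i \<ge> 1 \<Longrightarrow> AE w in \<Omega>.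
        nn_cond_exp \<Omega> (vimage_algebra (space \<Omega>) (X i) (restrict_space borel \<X>))
          (\<lambda>w. ennreal ((\<epsilon> i w)\<^sup>2)) w < \<infinity>"

type_synonym 'd procedure = "nat \<Rightarrow> (nat \<Rightarrow> (real ^ 'd) \<times> real) \<Rightarrow> real ^ 'd \<Rightarrow> real"

text \<open>
  Joint measurability in the sample and the point of evaluation makes the losses and the
  cross validation sums random variables.
\<close>

definition regression_procedure :: "(real ^ 'd) set \<Rightarrow> 'd procedure \<Rightarrow> bool" where
  "regression_procedure \<X> \<delta> \<longleftrightarrow>
     (\<forall>n\<ge>1. (\<lambda>(s, x). \<delta> n s x) \<in>
        borel_measurable ((\<Pi>\<^sub>M i\<in>{1..n}. obs_space \<X>) \<Otimes>\<^sub>M restrict_space borel \<X>))"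

definition estimator ::
    "(nat \<Rightarrow> 'w \<Rightarrow> real ^ 'd) \<Rightarrow> (nat \<Rightarrow> 'w \<Rightarrow> real) \<Rightarrow> 'd procedure \<Rightarrow> nat \<Rightarrow> 'w \<Rightarrow> real ^ 'd \<Rightarrow> real"
  where
  "estimator X Y \<delta> n w = \<delta> n (\<lambda>i\<in>{1..n}. (X i w, Y i w))"

text \<open>\<open>Z\<^sub>n = O\<^sub>p(a\<^sub>n)\<close> for nonnegative extended-real-valued \<open>Z\<^sub>n\<close>.\<close>

definition bigo_prob :: "'w measure \<Rightarrow> (nat \<Rightarrow> 'w \<Rightarrow> ennreal) \<Rightarrow> (nat \<Rightarrow> real) \<Rightarrow> bool" where
  "bigo_prob \<Omega> Z a \<longleftrightarrow>
     (\<forall>e\<in>{0<..<1}. \<exists>K>0. \<forall>\<^sub>F n in sequentially.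
        measure \<Omega> {w \<in> space \<Omega>. Z n w \<le> ennreal (K * a n)} \<ge> 1 - e)"

definition asymptotically_better ::
    "'w measure \<Rightarrow> ('t \<Rightarrow> 't \<Rightarrow> ennreal) \<Rightarrow> 't \<Rightarrow> (nat \<Rightarrow> 'w \<Rightarrow> 't) \<Rightarrow> (nat \<Rightarrow> 'w \<Rightarrow> 't) \<Rightarrow> bool"
  where
  "asymptotically_better \<Omega> L \<theta> est1 est2 \<longleftrightarrow>
     (\<forall>e\<in>{0<..<1}. \<exists>c>0. \<forall>\<^sub>F n in sequentially.
        measure \<Omega> {w \<in> space \<Omega>. L \<theta> (est2 n w) \<ge> ennreal (1 + c) * L \<theta> (est1 n w)} \<ge> 1 - e)"

definition converges_exactly_at_rate ::
    "'w measure \<Rightarrow> ('t \<Rightarrow> 't \<Rightarrow> ennreal) \<Rightarrow> 't \<Rightarrow> (nat \<Rightarrow> 'w \<Rightarrow> 't) \<Rightarrow> (nat \<Rightarrow> real) \<Rightarrow> bool"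
  where
  "converges_exactly_at_rate \<Omega> L \<theta> est a \<longleftrightarrow>
     (\<forall>n\<ge>1. a n > 0) \<and> a \<longlonglongrightarrow> 0 \<and>
     bigo_prob \<Omega> (\<lambda>n w. L \<theta> (est n w)) a \<and>
     (\<forall>e\<in>{0<..<1}. \<exists>c>0. \<forall>\<^sub>F n in sequentially.
        measure \<Omega> {w \<in> space \<Omega>. L \<theta> (est n w) \<ge> ennreal (c * a n)} \<ge> 1 - e)"

text \<open>
  The argument \<open>z\<close> below holds the reordered observations at the indices \<open>{1..n}\<close>; the first
  \<open>n\<^sub>1\<close> of them are used for estimation and the others for validation.
\<close>

definition cv_criterion ::
    "nat \<Rightarrow> nat \<Rightarrow> 'd procedure \<Rightarrow> (nat \<Rightarrow> (real ^ 'd) \<times> real) \<Rightarrow> real" where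
  "cv_criterion n n\<^sub>1 \<delta> z =
     (\<Sum>i\<in>{n\<^sub>1<..n}. (snd (z i) - \<delta> n\<^sub>1 (restrict z {1..n\<^sub>1}) (fst (z i)))\<^sup>2)"

definition cv_vote ::
    "nat \<Rightarrow> nat \<Rightarrow> 'd procedure \<Rightarrow> 'd procedure \<Rightarrow> (nat \<Rightarrow> (real ^ 'd) \<times> real) \<Rightarrow> nat" where
  "cv_vote n n\<^sub>1 \<delta>\<^sub>1 \<delta>\<^sub>2 z = (if cv_criterion n n\<^sub>1 \<delta>\<^sub>1 z \<le> cv_criterion n n\<^sub>1 \<delta>\<^sub>2 z then 1 else 0)"

definition cvv_select ::
    "nat \<Rightarrow> nat \<Rightarrow> 'd procedure \<Rightarrow> 'd procedure \<Rightarrow> (nat \<Rightarrow> (real ^ 'd) \<times> real) \<Rightarrow> nat" where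
  "cvv_select n n\<^sub>1 \<delta>\<^sub>1 \<delta>\<^sub>2 z =
     (if real (\<Sum>\<pi> | \<pi> permutes {1..n}. cv_vote n n\<^sub>1 \<delta>\<^sub>1 \<delta>\<^sub>2 (z \<circ> \<pi>)) \<ge> fact n / 2 then 1 else 2)"

end

theory Submission
  imports Defs
begin

text \<open>
  Fix one data split and condition on the estimation part. The difference of the two validation
  sums is a sum of \<open>n\<^sub>2\<close> i.i.d. terms \<open>D\<^sub>b\<^sup>2 - D\<^sub>a\<^sup>2 + 2 \<epsilon> (D\<^sub>b - D\<^sub>a)\<close>, where \<open>D\<^sub>a\<close>, \<open>D\<^sub>b\<close> are the estimation
  errors of the better and the worse procedure. With large probability their mean is at least a
  multiple of \<open>\<parallel>D\<^sub>b\<parallel>\<^sub>2\<^sup>2\<close> and their second moment at most a constant times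
  \<open>M\<^sup>4 \<parallel>D\<^sub>b\<parallel>\<^sub>2\<^sup>4 + \<sigma>2 \<parallel>D\<^sub>b\<parallel>\<^sub>2\<^sup>2\<close>, so by Chebyshev's inequality the split votes for the worse procedure
  with probability \<open>O(M\<^sup>4 / n\<^sub>2 + 1 / (n\<^sub>2 max(p, q)\<^sup>2))\<close>, which tends to \<open>0\<close>. By exchangeability this bound is the
  same for every permutation of the observations, and Markov's inequality for the fraction of wrong
  votes turns it into a bound for the probability of a wrong majority.
\<close>

subsection \<open>Sums of independent variables and voting\<close>

text \<open>Chebyshev's inequality: a nonpositive sum lies at least \<open>card I * m\<close> below
  its mean, and the variance of the sum is at most \<open>card I\<close> times the second moment of
  \<open>h\<close>.\<close>

lemma iid_sum_nonpos_prob: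
  fixes h :: "'a \<Rightarrow> real"
  assumes Q: "prob_space Q" and I: "finite I" "I \<noteq> {}"
    and h[measurable]: "h \<in> borel_measurable Q"
    and h2: "integrable Q (\<lambda>x. (h x)\<^sup>2)"
    and pos: "(\<integral>x. h x \<partial>Q) > 0"
  shows "measure (\<Pi>\<^sub>M i\<in>I. Q) {t \<in> space (\<Pi>\<^sub>M i\<in>I. Q). (\<Sum>i\<in>I. h (t i)) \<le> 0}
    \<le> (\<integral>x. (h x)\<^sup>2 \<partial>Q) / (card I * (\<integral>x. h x \<partial>Q)\<^sup>2)"
proof -
  interpret Q: prob_space Q by (rule Q)
  interpret product_prob_space "\<lambda>_. Q" I
    by (intro product_prob_spaceI Q)
  let ?R = "\<Pi>\<^sub>M i\<in>I. Q"
  define m where "m = (\<integral>x. h x \<partial>Q)"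
  define k where "k x = h x - m" for x
  have k[measurable]: "k \<in> borel_measurable Q"
    unfolding k_def by measurable
  have h1: "integrable Q h"
    using Q.square_integrable_imp_integrable[OF h h2] .
  have k1: "integrable Q k" and k0: "(\<integral>x. k x \<partial>Q) = 0"
    unfolding k_def using h1 by (auto simp: m_def Q.prob_space)
  have k2_eq: "(k x)\<^sup>2 = (h x)\<^sup>2 - 2 * m * h x + m\<^sup>2" for x
    by (simp add: k_def power2_eq_square algebra_simps)
  have k2: "integrable Q (\<lambda>x. (k x)\<^sup>2)"
    unfolding k2_eq using h1 h2 by auto
  have "(\<integral>x. (k x)\<^sup>2 \<partial>Q) = (\<integral>x. (h x)\<^sup>2 \<partial>Q) - m\<^sup>2"
    unfolding k2_eq using h1 h2 by (simp add: m_def[symmetric] Q.prob_space power2_eq_square)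
  then have k2_le: "(\<integral>x. (k x)\<^sup>2 \<partial>Q) \<le> (\<integral>x. (h x)\<^sup>2 \<partial>Q)" by simp
  define E where "E i j = (\<integral>t. k (t i) * k (t j) \<partial>?R)" for i j
  have cross: "integrable ?R (\<lambda>t. k (t i) * k (t j)) \<and>
      E i j = (if i = j then (\<integral>x. (k x)\<^sup>2 \<partial>Q) else 0)"
    if ij: "i \<in> I" "j \<in> I" for i j
  proof -
    \<comment> \<open>Writing the product as one factor per coordinate, equal to 1 away from
      \<open>i\<close> and \<open>j\<close>, lets Fubini factorise the integral in the diagonal and
      the off-diagonal case alike. Off the diagonal the factor at \<open>i\<close> is the vanishing
      integral of \<open>k\<close>.\<close>
    define g where "g l = (\<lambda>x. (if l = i then k x else 1) * (if l = j then k x else 1))" for l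
    have g1: "integrable Q (g l)" for l
      using k1 k2 by (cases "l = i"; cases "l = j") (auto simp: g_def power2_eq_square)
    have prod_g: "(\<Prod>l\<in>I. g l (t l)) = k (t i) * k (t j)" for t
      unfolding g_def prod.distrib using ij I by (simp add: prod.delta)
    have "(\<Prod>l\<in>I. \<integral>x. g l x \<partial>Q) = (if i = j then (\<integral>x. (k x)\<^sup>2 \<partial>Q) else 0)"
    proof (cases "i = j")
      case True
      have "(\<Prod>l\<in>I. \<integral>x. g l x \<partial>Q) = (\<Prod>l\<in>I. if l = i then (\<integral>x. (k x)\<^sup>2 \<partial>Q) else 1)"
        using True by (intro prod.cong) (auto simp: g_def power2_eq_square Q.prob_space)
      then show ?thesis using True ij I by (simp add: prod.delta)
    next
      case False
      then have "(\<integral>x. g i x \<partial>Q) = 0" using k0 by (simp add: g_def)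
      then show ?thesis using False ij I by (auto intro: prod_zero)
    qed
    then show ?thesis
      using product_integral_prod[OF I(1), of g] product_integrable_prod[OF I(1), of g] g1
      by (simp add: prod_g E_def)
  qed
  have sq: "(\<Sum>i\<in>I. k (t i))\<^sup>2 = (\<Sum>i\<in>I. \<Sum>j\<in>I. k (t i) * k (t j))" for t
    by (simp add: power2_eq_square sum_product)
  have int_E: "integrable ?R (\<lambda>t. k (t i) * k (t j))" if "i \<in> I" "j \<in> I" for i j
    using cross[OF that] by simp
  have int_row: "integrable ?R (\<lambda>t. \<Sum>j\<in>I. k (t i) * k (t j))" if "i \<in> I" for i
    by (rule Bochner_Integration.integrable_sum) (rule int_E[OF that])
  have int_sq: "integrable ?R (\<lambda>t. (\<Sum>i\<in>I. k (t i))\<^sup>2)"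
    unfolding sq by (rule Bochner_Integration.integrable_sum) (rule int_row)
  have "(\<integral>t. (\<Sum>i\<in>I. k (t i))\<^sup>2 \<partial>?R) = (\<Sum>i\<in>I. \<integral>t. (\<Sum>j\<in>I. k (t i) * k (t j)) \<partial>?R)"
    unfolding sq by (rule Bochner_Integration.integral_sum) (rule int_row)
  also have "\<dots> = (\<Sum>i\<in>I. \<Sum>j\<in>I. E i j)"
    unfolding E_def by (intro sum.cong refl Bochner_Integration.integral_sum int_E)
  also have "\<dots> = (\<Sum>i\<in>I. \<Sum>j\<in>I. if i = j then (\<integral>x. (k x)\<^sup>2 \<partial>Q) else 0)"
    using cross by (simp cong: sum.cong)
  also have "\<dots> = card I * (\<integral>x. (k x)\<^sup>2 \<partial>Q)"
    using I by (simp add: sum.delta)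
  finally have var: "(\<integral>t. (\<Sum>i\<in>I. k (t i))\<^sup>2 \<partial>?R) \<le> card I * (\<integral>x. (h x)\<^sup>2 \<partial>Q)"
    using k2_le by (simp add: mult_left_mono)
  have cardpos: "card I > 0" using I by (simp add: card_gt_0_iff)
  have mpos: "m > 0" using pos by (simp add: m_def)
  have sub: "{t \<in> space ?R. (\<Sum>i\<in>I. h (t i)) \<le> 0}
      \<subseteq> {t \<in> space ?R. (card I * m)\<^sup>2 \<le> (\<Sum>i\<in>I. k (t i))\<^sup>2}"
  proof safe
    fix t assume "(\<Sum>i\<in>I. h (t i)) \<le> 0"
    then have "card I * m \<le> - (\<Sum>i\<in>I. k (t i))"
      by (simp add: k_def sum_subtractf)
    then have "(card I * m)\<^sup>2 \<le> (- (\<Sum>i\<in>I. k (t i)))\<^sup>2"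
      using mpos by (intro power_mono) auto
    then show "(card I * m)\<^sup>2 \<le> (\<Sum>i\<in>I. k (t i))\<^sup>2" by simp
  qed
  have "measure ?R {t \<in> space ?R. (\<Sum>i\<in>I. h (t i)) \<le> 0}
      \<le> measure ?R {t \<in> space ?R. (card I * m)\<^sup>2 \<le> (\<Sum>i\<in>I. k (t i))\<^sup>2}"
    by (rule P.finite_measure_mono[OF sub]) measurable
  also have "\<dots> \<le> (\<integral>t. (\<Sum>i\<in>I. k (t i))\<^sup>2 \<partial>?R) / (card I * m)\<^sup>2"
    using int_sq cardpos mpos by (intro integral_Markov_inequality_measure[where A="{}"]) auto
  also have "\<dots> \<le> card I * (\<integral>x. (h x)\<^sup>2 \<partial>Q) / (card I * m)\<^sup>2"
    using var by (intro divide_right_mono) auto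
  also have "\<dots> = (\<integral>x. (h x)\<^sup>2 \<partial>Q) / (card I * m\<^sup>2)"
    using cardpos by (simp add: power2_eq_square field_simps)
  finally show ?thesis by (simp add: m_def)
qed

text \<open>By independence the joint law over \<open>J\<close> is a power of \<open>Q\<close>, and
  selecting distinct coordinates from a power of \<open>Q\<close> gives a power of \<open>Q\<close>
  again.\<close>

lemma (in prob_space) distr_iid_subfamily:
  assumes indep: "indep_vars (\<lambda>_. N) Z J"
    and id: "\<And>j. j \<in> J \<Longrightarrow> distr M N (Z j) = Q"
    and r: "inj_on r I" "r ` I \<subseteq> J" "J \<noteq> {}"
  shows "distr M (\<Pi>\<^sub>M i\<in>I. N) (\<lambda>w. \<lambda>i\<in>I. Z (r i) w) = (\<Pi>\<^sub>M i\<in>I. Q)"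
proof -
  have rv: "random_variable N (Z j)" if "j \<in> J" for j
    using indep that by (auto simp: indep_vars_def)
  obtain j where j: "j \<in> J" using r(3) by blast
  have sQ: "sets Q = sets N" using id[OF j] by (metis sets_distr)
  have pQ: "prob_space Q" using prob_space_distr[OF rv[OF j]] id[OF j] by simp
  have "distr M (\<Pi>\<^sub>M j\<in>J. N) (\<lambda>w. \<lambda>j\<in>J. Z j w) = (\<Pi>\<^sub>M j\<in>J. distr M N (Z j))"
    using indep indep_vars_iff_distr_eq_PiM'[OF r(3), where M'="\<lambda>_. N" and X=Z] rv by blast
  also have "\<dots> = (\<Pi>\<^sub>M j\<in>J. Q)"
    using id by (intro PiM_cong) auto
  finally have full: "distr M (\<Pi>\<^sub>M j\<in>J. N) (\<lambda>w. \<lambda>j\<in>J. Z j w) = (\<Pi>\<^sub>M j\<in>J. Q)" .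
  have "(\<Pi>\<^sub>M i\<in>I. Q) = distr (\<Pi>\<^sub>M j\<in>J. Q) (\<Pi>\<^sub>M i\<in>I. Q) (\<lambda>u. \<lambda>i\<in>I. u (r i))"
    using distr_PiM_reindex[of J "\<lambda>_. Q" r I] r pQ by (auto simp: image_subset_iff)
  also have "\<dots> = distr (distr M (\<Pi>\<^sub>M j\<in>J. N) (\<lambda>w. \<lambda>j\<in>J. Z j w)) (\<Pi>\<^sub>M i\<in>I. N) (\<lambda>u. \<lambda>i\<in>I. u (r i))"
    unfolding full by (intro distr_cong sets_PiM_cong sQ refl)
  also have "\<dots> = distr M (\<Pi>\<^sub>M i\<in>I. N) ((\<lambda>u. \<lambda>i\<in>I. u (r i)) \<circ> (\<lambda>w. \<lambda>j\<in>J. Z j w))"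
    using rv r(2)
    by (intro distr_distr measurable_restrict measurable_component_singleton) auto
  also have "\<dots> = distr M (\<Pi>\<^sub>M i\<in>I. N) (\<lambda>w. \<lambda>i\<in>I. Z (r i) w)"
    using r(2) by (intro distr_cong) (auto simp: fun_eq_iff restrict_def)
  finally show ?thesis by simp
qed

text \<open>Markov's inequality for the number of events \<open>B s\<close> that occur: outside
  \<open>C\<close> at least half of them occur, while the expected number is at most
  \<open>card S * b\<close>. Only linearity of expectation enters, so the \<open>B s\<close> may
  depend on each other arbitrarily, as votes from overlapping splits do.\<close>

lemma (in prob_space) prob_majority_ge:
  assumes S: "finite S" "S \<noteq> {}"
    and B: "\<And>s. s \<in> S \<Longrightarrow> B s \<in> events" "\<And>s. s \<in> S \<Longrightarrow> prob (B s) \<le> b"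
    and C: "C \<in> events"
    and maj: "\<And>w. w \<in> space M - C \<Longrightarrow> card S \<le> 2 * card {s\<in>S. w \<in> B s}"
  shows "prob C \<ge> 1 - 2 * b"
proof -
  have S0: "card S > 0" using S by (simp add: card_gt_0_iff)
  have card_eq: "real (card {s\<in>S. w \<in> B s}) = (\<Sum>s\<in>S. indicat_real (B s) w)" for w
    using S by (simp add: indicator_def sum.If_cases Int_def)
  have "card S * prob (space M - C) = (\<integral>w. card S * indicat_real (space M - C) w \<partial>M)"
    using C by simp
  also have "\<dots> \<le> (\<integral>w. 2 * (\<Sum>s\<in>S. indicat_real (B s) w) \<partial>M)"
  proof (intro integral_mono)
    show "integrable M (\<lambda>w. card S * indicat_real (space M - C) w)"
      using C by (auto simp: emeasure_eq_measure)
    show "integrable M (\<lambda>w. 2 * (\<Sum>s\<in>S. indicat_real (B s) w))"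
      using B by (auto simp: emeasure_eq_measure)
    fix w
    show "card S * indicat_real (space M - C) w \<le> 2 * (\<Sum>s\<in>S. indicat_real (B s) w)"
    proof (cases "w \<in> space M - C")
      case True
      from maj[OF this] have "real (card S) \<le> 2 * real (card {s\<in>S. w \<in> B s})" by linarith
      then show ?thesis using True by (simp add: card_eq)
    next
      case False
      then show ?thesis by (simp add: sum_nonneg)
    qed
  qed
  also have "\<dots> = 2 * (\<Sum>s\<in>S. prob (B s))"
    using B by (simp add: emeasure_eq_measure)
  also have "\<dots> \<le> 2 * (card S * b)"
    using sum_bounded_above[of S "\<lambda>s. prob (B s)" b] B by simp
  finally have "prob (space M - C) \<le> 2 * b" using S0 by (simp add: field_simps)
  then show ?thesis using prob_compl[OF C] by simp
qed

text \<open>Fubini with the \<open>I\<close>-coordinates held fixed: the section of \<open>B\<close>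
  has measure at most \<eta> over \<open>G\<close> and at most 1 elsewhere. Later \<open>I\<close>
  indexes the estimation part and \<open>J\<close> the validation part.\<close>

lemma measure_PiM_Un_le:
  assumes Q: "prob_space Q" and IJ: "finite I" "finite J" "I \<inter> J = {}"
    and G: "G \<in> sets (\<Pi>\<^sub>M i\<in>I. Q)" and B: "B \<in> sets (\<Pi>\<^sub>M i\<in>I \<union> J. Q)"
    and eta: "\<eta> \<ge> 0"
    and le: "\<And>s. s \<in> G \<Longrightarrow>
      measure (\<Pi>\<^sub>M i\<in>J. Q) {t \<in> space (\<Pi>\<^sub>M i\<in>J. Q). merge I J (s, t) \<in> B} \<le> \<eta>"
  shows "measure (\<Pi>\<^sub>M i\<in>I \<union> J. Q) B \<le> (1 - measure (\<Pi>\<^sub>M i\<in>I. Q) G) + \<eta>"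
proof -
  interpret Q: prob_space Q by (rule Q)
  interpret product_sigma_finite "\<lambda>_. Q" by standard
  let ?I = "\<Pi>\<^sub>M i\<in>I. Q" and ?J = "\<Pi>\<^sub>M i\<in>J. Q" and ?U = "\<Pi>\<^sub>M i\<in>I \<union> J. Q"
  interpret PI: prob_space ?I by (intro prob_space_PiM Q)
  interpret PJ: prob_space ?J by (intro prob_space_PiM Q)
  interpret PU: prob_space ?U by (intro prob_space_PiM Q)
  have "emeasure ?U B = (\<integral>\<^sup>+s. emeasure ?J ((\<lambda>t. merge I J (s, t)) -` B \<inter> space ?J) \<partial>?I)"
    by (rule emeasure_fold_integral[OF IJ(3,1,2) B])
  also have "\<dots> \<le> (\<integral>\<^sup>+s. indicator (space ?I - G) s + ennreal \<eta> \<partial>?I)"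
  proof (intro nn_integral_mono)
    fix s assume s: "s \<in> space ?I"
    have eq: "(\<lambda>t. merge I J (s, t)) -` B \<inter> space ?J = {t \<in> space ?J. merge I J (s, t) \<in> B}"
      by auto
    show "emeasure ?J ((\<lambda>t. merge I J (s, t)) -` B \<inter> space ?J) \<le> indicator (space ?I - G) s + ennreal \<eta>"
    proof (cases "s \<in> G")
      case True
      then show ?thesis
        using le[OF True] by (simp add: eq PJ.emeasure_eq_measure ennreal_leI)
    next
      case False
      then have "indicator (space ?I - G) s = (1 :: ennreal)" using s by simp
      then show ?thesis
        using PJ.measure_le_1 by (simp add: add_increasing2)
    qed
  qed
  also have "\<dots> = emeasure ?I (space ?I - G) + ennreal \<eta>"
    using G by (subst nn_integral_add) (auto simp: PI.emeasure_space_1)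
  also have "\<dots> = ennreal (1 - measure ?I G + \<eta>)"
    using G eta PI.prob_compl[OF G] by (simp add: PI.emeasure_eq_measure ennreal_plus)
  finally have "ennreal (measure ?U B) \<le> ennreal (1 - measure ?I G + \<eta>)"
    by (simp only: PU.emeasure_eq_measure)
  then show ?thesis
    using eta PI.prob_le_1[of G] by (subst (asm) ennreal_le_iff) auto
qed

lemma (in prob_space) prob_Int_ge:
  assumes "A \<in> events" "B \<in> events" "prob A \<ge> 1 - a" "prob B \<ge> 1 - b"
  shows "prob (A \<inter> B) \<ge> 1 - (a + b)"
proof -
  have "prob (A \<union> B) = prob A + prob B - prob (A \<inter> B)"
    using assms by (simp add: measure_Un3 fmeasurable_eq_sets)
  then show ?thesis using assms prob_le_1[of "A \<union> B"] by simp
qed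

text \<open>Serves the measurability of the set of good estimation samples: \<open>A\<close>,
  \<open>B\<close> stand for the two L2 losses and \<open>A'\<close>, \<open>B'\<close> for the
  corresponding L4 norms, as functions of the sample.\<close>

lemma sets_Collect_ratio_bounds:
  fixes A B A' B' :: "'a \<Rightarrow> ennreal"
  assumes [measurable]: "A \<in> borel_measurable S" "B \<in> borel_measurable S"
    "A' \<in> borel_measurable S" "B' \<in> borel_measurable S"
  shows "{s \<in> space S. B s \<ge> c * A s \<and> B s \<ge> u \<and> B s < \<infinity> \<and>
    A' s / A s \<le> k \<and> B' s / B s \<le> k} \<in> sets S"
proof -
  have [measurable]: "(\<lambda>s. c * A s) \<in> borel_measurable S" "(\<lambda>s. A' s / A s) \<in> borel_measurable S"
    "(\<lambda>s. B' s / B s) \<in> borel_measurable S"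
    by measurable
  show ?thesis
    by (intro sets.sets_Collect_conj borel_measurable_le borel_measurable_less borel_measurable_const; fact)
qed

subsection \<open>The regression model\<close>

lemma nn_integral_of_Lq_norm:
  assumes "Lq_norm P q g = ennreal a" "a \<ge> 0" "q > 0"
  shows "(\<integral>\<^sup>+x. ennreal (\<bar>g x\<bar> powr q) \<partial>P) = ennreal (a powr q)"
proof -
  define I where "I = (\<integral>\<^sup>+x. ennreal (\<bar>g x\<bar> powr q) \<partial>P)"
  \<comment> \<open>A norm of the form \<open>ennreal a\<close> rules out the infinite branch of the
    definition, so \<open>enn2real\<close> loses nothing.\<close>
  have fin: "I \<noteq> \<infinity>" and "ennreal (enn2real I powr (1 / q)) = ennreal a"
    using assms(1) by (auto simp: Lq_norm_def Let_def I_def split: if_splits)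
  then have "enn2real I powr (1 / q) = a"
    using assms(2) by (simp add: ennreal_inj)
  then have "a powr q = enn2real I"
    using assms(3) by (auto simp: powr_powr)
  then show ?thesis using fin by (simp add: I_def less_top)
qed

lemma square_integral_of_Lq_norm:
  assumes [measurable]: "g \<in> borel_measurable P"
    and "Lq_norm P 2 g = ennreal a" "a \<ge> 0"
  shows "integrable P (\<lambda>x. (g x)\<^sup>2)" "(\<integral>x. (g x)\<^sup>2 \<partial>P) = a\<^sup>2"
proof -
  have *: "(\<integral>\<^sup>+x. ennreal ((g x)\<^sup>2) \<partial>P) = ennreal (a\<^sup>2)"
    using nn_integral_of_Lq_norm[OF assms(2,3)] assms(3) by simp
  show "integrable P (\<lambda>x. (g x)\<^sup>2)"
    using * by (intro integrableI_nonneg) auto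
  show "(\<integral>x. (g x)\<^sup>2 \<partial>P) = a\<^sup>2"
    using * by (subst integral_eq_nn_integral) auto
qed

text \<open>An inequality suffices as input because the norm ratios are controlled only from
  above.\<close>

lemma fourth_power_integral_of_Lq_norm:
  assumes [measurable]: "g \<in> borel_measurable P"
    and le: "Lq_norm P 4 g \<le> ennreal a" and a: "a \<ge> 0"
  shows "integrable P (\<lambda>x. (g x) ^ 4)" "(\<integral>x. (g x) ^ 4 \<partial>P) \<le> a ^ 4"
proof -
  define b where "b = enn2real (Lq_norm P 4 g)"
  have b: "Lq_norm P 4 g = ennreal b" "b \<ge> 0"
    using le_less_trans[OF le ennreal_less_top] by (simp_all add: b_def)
  then have ba: "b \<le> a" using le a by (simp add: ennreal_le_iff)
  have *: "(\<integral>\<^sup>+x. ennreal ((g x) ^ 4) \<partial>P) = ennreal (b ^ 4)"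
    using nn_integral_of_Lq_norm[OF b] b(2) by simp
  show "integrable P (\<lambda>x. (g x) ^ 4)"
    using * by (intro integrableI_nonneg) auto
  have "(\<integral>x. (g x) ^ 4 \<partial>P) = b ^ 4"
    using * by (subst integral_eq_nn_integral) (auto simp: b)
  then show "(\<integral>x. (g x) ^ 4 \<partial>P) \<le> a ^ 4"
    using ba b(2) by (simp add: power_mono)
qed

text \<open>Turns a bound on the norm ratio into one on the L4 norm, even where the L2 norm
  vanishes: \<open>x / 0\<close> is infinite for \<open>x > 0\<close>, so a finite ratio forces
  \<open>x = 0\<close>.\<close>

lemma ennreal_le_mult_of_divide_le:
  assumes "x / ennreal b \<le> ennreal k" "b \<ge> 0" "k \<ge> 0"
  shows "x \<le> ennreal (k * b)"
proof (cases "b = 0")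
  case True
  then have "x = 0" using assms(1) by (cases "x = 0") (auto simp: ennreal_divide_zero top_unique)
  then show ?thesis by simp
next
  case False
  then have "x = x / ennreal b * ennreal b"
    using assms(2) by (simp add: ennreal_divide_times ennreal_mult_divide_eq)
  also have "\<dots> \<le> ennreal k * ennreal b"
    using assms(1) by (intro mult_right_mono) auto
  finally show ?thesis using assms by (simp add: ennreal_mult)
qed

context regression_setting
begin

section \<open>Measurability and the sigma-algebra of a covariate\<close>

lemma X_measurable: "i \<ge> 1 \<Longrightarrow> X i \<in> measurable \<Omega> (restrict_space borel \<X>)"
  using X_indep by (auto simp: indep_vars_def)

lemma sets_PX: "sets P\<^sub>X = sets (restrict_space borel \<X>)"
  using X_distr[of 1] by (metis le_refl sets_distr)

lemma prob_space_PX: "prob_space P\<^sub>X"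
  using X_distr[of 1] X_measurable[of 1] prob_space_distr by (metis le_refl)

lemma Y_measurable: "i \<ge> 1 \<Longrightarrow> random_variable borel (Y i)"
proof -
  assume i: "i \<ge> 1"
  note [measurable] = X_measurable[OF i] error_measurable[OF i] regression_function_measurable
  have "random_variable borel (\<lambda>w. f (X i w) + \<epsilon> i w)" by measurable
  then show ?thesis using model[OF i] by (simp cong: measurable_cong)
qed

lemma observation_measurable: "i \<ge> 1 \<Longrightarrow> (\<lambda>w. (X i w, Y i w)) \<in> measurable \<Omega> (obs_space \<X>)"
  unfolding obs_space_def using X_measurable Y_measurable by measurable

lemma covariate_subalgebra:
  assumes "i \<ge> 1"
  shows "finite_measure_subalgebra \<Omega> (vimage_algebra (space \<Omega>) (X i) (restrict_space borel \<X>))"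
proof
  show "subalgebra \<Omega> (vimage_algebra (space \<Omega>) (X i) (restrict_space borel \<X>))"
    using X_measurable[OF assms] measurable_sets[OF X_measurable[OF assms]]
    by (auto simp: subalgebra_def sets_vimage_algebra2 measurable_def Pi_iff)
qed

text \<open>Allows functions of \<open>X i\<close> to be pulled out of conditional expectations
  given \<open>X i\<close>.\<close>

lemma covariate_function_measurable:
  assumes "i \<ge> 1" "g \<in> borel_measurable (restrict_space borel \<X>)"
  shows "(\<lambda>w. g (X i w)) \<in> borel_measurable (vimage_algebra (space \<Omega>) (X i) (restrict_space borel \<X>))"
proof -
  have "X i \<in> measurable (vimage_algebra (space \<Omega>) (X i) (restrict_space borel \<X>)) (restrict_space borel \<X>)"
    using X_measurable[OF assms(1)] by (intro measurable_vimage_algebra1) (auto simp: measurable_def)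
  from measurable_compose[OF this assms(2)] show ?thesis .
qed

section \<open>Moments of covariate functions and of the noise\<close>

lemma covariate_integral:
  assumes i: "i \<ge> 1" and g: "(g :: _ \<Rightarrow> real) \<in> borel_measurable (restrict_space borel \<X>)"
    and int: "integrable P\<^sub>X g"
  shows "integrable \<Omega> (\<lambda>w. g (X i w))" "(\<integral>w. g (X i w) \<partial>\<Omega>) = (\<integral>x. g x \<partial>P\<^sub>X)"
proof -
  show "integrable \<Omega> (\<lambda>w. g (X i w))"
    using int integrable_distr_eq[OF X_measurable[OF i] g] X_distr[OF i] by simp
  show "(\<integral>w. g (X i w) \<partial>\<Omega>) = (\<integral>x. g x \<partial>P\<^sub>X)"
    using integral_distr[OF X_measurable[OF i] g] X_distr[OF i] by simp
qed

text \<open>The factor \<open>(g (X i w))\<^sup>2\<close> is measurable with respect to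
  \<open>X i\<close>, so conditioning replaces the squared noise by its conditional expectation,
  which is at most \<open>s\<close>. Working with nonnegative integrals makes integrability a
  consequence of the bound.\<close>

lemma noise_square_integral:
  assumes i: "i \<ge> 1" and s: "s \<ge> 0"
    and var: "AE w in \<Omega>. nn_cond_exp \<Omega> (vimage_algebra (space \<Omega>) (X i) (restrict_space borel \<X>))
         (\<lambda>w. ennreal ((\<epsilon> i w)\<^sup>2)) w \<le> ennreal s"
    and g: "g \<in> borel_measurable (restrict_space borel \<X>)"
    and g2: "integrable P\<^sub>X (\<lambda>x. (g x)\<^sup>2)"
  shows "integrable \<Omega> (\<lambda>w. (\<epsilon> i w * g (X i w))\<^sup>2)"
    "(\<integral>w. (\<epsilon> i w * g (X i w))\<^sup>2 \<partial>\<Omega>) \<le> s * (\<integral>x. (g x)\<^sup>2 \<partial>P\<^sub>X)"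
proof -
  let ?F = "vimage_algebra (space \<Omega>) (X i) (restrict_space borel \<X>)"
  interpret F: finite_measure_subalgebra \<Omega> ?F by (rule covariate_subalgebra[OF i])
  note [measurable] = X_measurable[OF i] error_measurable[OF i] g
  have gF: "(\<lambda>w. ennreal ((g (X i w))\<^sup>2)) \<in> borel_measurable ?F"
    using covariate_function_measurable[OF i g] by measurable
  have "(\<integral>\<^sup>+w. ennreal ((\<epsilon> i w * g (X i w))\<^sup>2) \<partial>\<Omega>)
      = (\<integral>\<^sup>+w. ennreal ((g (X i w))\<^sup>2) * ennreal ((\<epsilon> i w)\<^sup>2) \<partial>\<Omega>)"
    by (intro nn_integral_cong) (simp add: ennreal_mult' power_mult_distrib mult.commute)
  also have "\<dots> = (\<integral>\<^sup>+w. ennreal ((g (X i w))\<^sup>2) * nn_cond_exp \<Omega> ?F (\<lambda>w. ennreal ((\<epsilon> i w)\<^sup>2)) w \<partial>\<Omega>)"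
    by (rule F.nn_cond_exp_intg[symmetric, OF gF]) measurable
  also have "\<dots> \<le> (\<integral>\<^sup>+w. ennreal s * ennreal ((g (X i w))\<^sup>2) \<partial>\<Omega>)"
    using var by (intro nn_integral_mono_AE, eventually_elim)
      (subst mult.commute, auto intro: mult_right_mono)
  also have "\<dots> = ennreal s * (\<integral>\<^sup>+w. ennreal ((g (X i w))\<^sup>2) \<partial>\<Omega>)"
    by (rule nn_integral_cmult) measurable
  also have "(\<integral>\<^sup>+w. ennreal ((g (X i w))\<^sup>2) \<partial>\<Omega>) = ennreal (\<integral>w. (g (X i w))\<^sup>2 \<partial>\<Omega>)"
    using covariate_integral(1)[OF i _ g2] by (intro nn_integral_eq_integral) auto
  also have "(\<integral>w. (g (X i w))\<^sup>2 \<partial>\<Omega>) = (\<integral>x. (g x)\<^sup>2 \<partial>P\<^sub>X)"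
    using covariate_integral(2)[OF i _ g2] by auto
  finally have *: "(\<integral>\<^sup>+w. ennreal ((\<epsilon> i w * g (X i w))\<^sup>2) \<partial>\<Omega>) \<le> ennreal (s * (\<integral>x. (g x)\<^sup>2 \<partial>P\<^sub>X))"
    using s by (simp add: ennreal_mult)
  show int: "integrable \<Omega> (\<lambda>w. (\<epsilon> i w * g (X i w))\<^sup>2)"
    using * by (intro integrableI_nonneg) (auto simp: le_less_trans)
  show "(\<integral>w. (\<epsilon> i w * g (X i w))\<^sup>2 \<partial>\<Omega>) \<le> s * (\<integral>x. (g x)\<^sup>2 \<partial>P\<^sub>X)"
    using * s nn_integral_eq_integral[OF int] by (simp add: ennreal_le_iff)
qed

text \<open>Conditioning on \<open>X i\<close> replaces the noise by its conditional mean, which is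
  zero almost surely. The integrability of the product is what the second-moment bound
  supplies.\<close>

lemma noise_mean:
  assumes i: "i \<ge> 1"
    and g: "g \<in> borel_measurable (restrict_space borel \<X>)"
    and int: "integrable \<Omega> (\<lambda>w. g (X i w) * \<epsilon> i w)"
  shows "(\<integral>w. g (X i w) * \<epsilon> i w \<partial>\<Omega>) = 0"
proof -
  let ?F = "vimage_algebra (space \<Omega>) (X i) (restrict_space borel \<X>)"
  interpret F: finite_measure_subalgebra \<Omega> ?F by (rule covariate_subalgebra[OF i])
  have "(\<integral>w. g (X i w) * \<epsilon> i w \<partial>\<Omega>) = (\<integral>w. g (X i w) * real_cond_exp \<Omega> ?F (\<epsilon> i) w \<partial>\<Omega>)"
    by (rule F.real_cond_exp_intg(2)[symmetric, OF int covariate_function_measurable[OF i g] error_measurable[OF i]])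
  also have "\<dots> = 0"
    using error_mean[OF i] by (intro integral_eq_zero_AE) auto
  finally show ?thesis .
qed

text \<open>The Chebyshev step for a fixed pair of estimates, that is, after conditioning on the
  estimation part. Dividing the second moment by the squared mean cancels the scale
  \<open>b\<close>, except in the noise term, which keeps a factor
  \<open>1 / b\<^sup>2\<close>.\<close>

lemma validation_gap_prob:
  fixes ga gb :: "real ^ 'd \<Rightarrow> real"
  defines "Q \<equiv> distr \<Omega> (obs_space \<X>) (\<lambda>w. (X 1 w, Y 1 w))"
  assumes s: "s \<ge> 0"
    and var: "AE w in \<Omega>. nn_cond_exp \<Omega> (vimage_algebra (space \<Omega>) (X 1) (restrict_space borel \<X>))
         (\<lambda>w. ennreal ((\<epsilon> 1 w)\<^sup>2)) w \<le> ennreal s"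
    and meas: "ga \<in> borel_measurable (restrict_space borel \<X>)" "gb \<in> borel_measurable (restrict_space borel \<X>)"
    and loss: "L2_loss P\<^sub>X f ga = ennreal a" "L2_loss P\<^sub>X f gb = ennreal b"
    and ab: "a \<ge> 0" "b > 0" "c > 0" "(1 + c) * a \<le> b"
    and L4: "K \<ge> 0" "Lq_norm P\<^sub>X 4 (\<lambda>x. f x - ga x) \<le> ennreal (K * a)"
      "Lq_norm P\<^sub>X 4 (\<lambda>x. f x - gb x) \<le> ennreal (K * b)"
    and I: "finite I" "I \<noteq> {}"
  shows "measure (\<Pi>\<^sub>M i\<in>I. Q) {t \<in> space (\<Pi>\<^sub>M i\<in>I. Q).
      (\<Sum>i\<in>I. (snd (t i) - gb (fst (t i)))\<^sup>2) \<le> (\<Sum>i\<in>I. (snd (t i) - ga (fst (t i)))\<^sup>2)}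
    \<le> (4 * K ^ 4 + 32 * s / b\<^sup>2) / (card I * (1 - 1 / (1 + c)\<^sup>2)\<^sup>2)"
proof -
  note One_nat_def[simp del]
  let ?N = "restrict_space borel \<X>"
  define Da where "Da x = f x - ga x" for x
  define Db where "Db x = f x - gb x" for x
  define G where "G x = Db x - Da x" for x
  note [measurable] = meas regression_function_measurable X_measurable[of 1] Y_measurable[of 1]
    error_measurable[of 1] observation_measurable[of 1]
  have D[measurable]: "Da \<in> borel_measurable ?N" "Db \<in> borel_measurable ?N" "G \<in> borel_measurable ?N"
    unfolding Da_def Db_def G_def by measurable
  have DP: "Da \<in> borel_measurable P\<^sub>X" "Db \<in> borel_measurable P\<^sub>X"
    using D by (simp_all cong: measurable_cong_sets add: sets_PX)
  have a2: "integrable P\<^sub>X (\<lambda>x. (Da x)\<^sup>2)" "(\<integral>x. (Da x)\<^sup>2 \<partial>P\<^sub>X) = a\<^sup>2"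
    using square_integral_of_Lq_norm[OF DP(1)] loss(1) ab by (auto simp: L2_loss_def Da_def[abs_def])
  have b2: "integrable P\<^sub>X (\<lambda>x. (Db x)\<^sup>2)" "(\<integral>x. (Db x)\<^sup>2 \<partial>P\<^sub>X) = b\<^sup>2"
    using square_integral_of_Lq_norm[OF DP(2)] loss(2) ab by (auto simp: L2_loss_def Db_def[abs_def])
  have a4: "integrable P\<^sub>X (\<lambda>x. (Da x) ^ 4)" "(\<integral>x. (Da x) ^ 4 \<partial>P\<^sub>X) \<le> (K * a) ^ 4"
    using fourth_power_integral_of_Lq_norm[OF DP(1), of "K * a"] L4 ab by (auto simp: Da_def[abs_def])
  have b4: "integrable P\<^sub>X (\<lambda>x. (Db x) ^ 4)" "(\<integral>x. (Db x) ^ 4 \<partial>P\<^sub>X) \<le> (K * b) ^ 4"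
    using fourth_power_integral_of_Lq_norm[OF DP(2), of "K * b"] L4 ab by (auto simp: Db_def[abs_def])
  have G_le: "(G x)\<^sup>2 \<le> 2 * (Da x)\<^sup>2 + 2 * (Db x)\<^sup>2" for x
    using zero_le_power2[of "Da x + Db x"] by (simp add: G_def power2_eq_square algebra_simps)
  have G2: "integrable P\<^sub>X (\<lambda>x. (G x)\<^sup>2)"
  proof (rule Bochner_Integration.integrable_bound)
    show "integrable P\<^sub>X (\<lambda>x. 2 * (Da x)\<^sup>2 + 2 * (Db x)\<^sup>2)" using a2 b2 by auto
    show "(\<lambda>x. (G x)\<^sup>2) \<in> borel_measurable P\<^sub>X" unfolding G_def using DP by measurable
  qed (use G_le in auto)
  have "(\<integral>x. (G x)\<^sup>2 \<partial>P\<^sub>X) \<le> (\<integral>x. 2 * (Da x)\<^sup>2 + 2 * (Db x)\<^sup>2 \<partial>P\<^sub>X)"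
    using G_le a2 b2 G2 by (intro integral_mono) auto
  also have "\<dots> = 2 * a\<^sup>2 + 2 * b\<^sup>2" using a2 b2 by simp
  finally have G2_le: "(\<integral>x. (G x)\<^sup>2 \<partial>P\<^sub>X) \<le> 2 * a\<^sup>2 + 2 * b\<^sup>2" .
  define e where "e w = \<epsilon> 1 w * G (X 1 w)" for w
  have [measurable]: "random_variable borel e" unfolding e_def by measurable
  have e2: "integrable \<Omega> (\<lambda>w. (e w)\<^sup>2)" "(\<integral>w. (e w)\<^sup>2 \<partial>\<Omega>) \<le> s * (2 * a\<^sup>2 + 2 * b\<^sup>2)"
    using noise_square_integral[OF _ s var D(3) G2] mult_left_mono[OF G2_le s]
    by (auto simp: e_def)
  have e1: "integrable \<Omega> e" using square_integrable_imp_integrable[OF _ e2(1)] by simp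
  have e0: "(\<integral>w. e w \<partial>\<Omega>) = 0"
    using noise_mean[OF _ D(3), of 1] e1 by (simp add: e_def[abs_def] mult.commute)
  define h where "h z = (snd z - gb (fst z))\<^sup>2 - (snd z - ga (fst z))\<^sup>2" for z :: "(real ^ 'd) \<times> real"
  have [measurable]: "h \<in> borel_measurable (obs_space \<X>)"
    unfolding h_def obs_space_def by measurable
  then have hQ: "h \<in> borel_measurable Q" by (simp add: Q_def)
  \<comment> \<open>The residuals are \<open>Da + \<epsilon>\<close> and
    \<open>Db + \<epsilon>\<close> at the covariate, so the squared noise cancels in the difference.
    The noise enters \<open>h\<close> only linearly, and its second moment controls that of
    \<open>h\<close>.\<close>
  have h_eq: "h (X 1 w, Y 1 w) = (Db (X 1 w))\<^sup>2 - (Da (X 1 w))\<^sup>2 + 2 * e w" if "w \<in> space \<Omega>" for w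
    using model[OF _ that, of 1]
    by (simp add: h_def e_def Da_def Db_def G_def power2_eq_square algebra_simps)
  note cov = covariate_integral[OF order_refl]
  have "(\<integral>z. h z \<partial>Q) = (\<integral>w. (Db (X 1 w))\<^sup>2 - (Da (X 1 w))\<^sup>2 + 2 * e w \<partial>\<Omega>)"
    unfolding Q_def by (subst integral_distr)
      (auto simp: h_eq intro!: Bochner_Integration.integral_cong)
  also have "\<dots> = b\<^sup>2 - a\<^sup>2"
    using cov[OF _ a2(1)] cov[OF _ b2(1)] e1 e0 a2 b2 by simp
  finally have mean: "(\<integral>z. h z \<partial>Q) = b\<^sup>2 - a\<^sup>2" .
  have h2_le: "(h (X 1 w, Y 1 w))\<^sup>2 \<le> 2 * (Da (X 1 w)) ^ 4 + 2 * (Db (X 1 w)) ^ 4 + 8 * (e w)\<^sup>2"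
    if "w \<in> space \<Omega>" for w
  proof -
    \<comment> \<open>The constants 2 and 8 come from the nonnegativity of
      \<open>(u - 2 * v)\<^sup>2\<close>. Dropping the nonpositive mixed term of the squared
      difference then leaves only fourth powers.\<close>
    have "(u + 2 * v)\<^sup>2 \<le> 2 * u\<^sup>2 + 8 * v\<^sup>2" for u v :: real
      using zero_le_power2[of "u - 2 * v"] by (simp add: power2_eq_square algebra_simps)
    from this[of "(Db (X 1 w))\<^sup>2 - (Da (X 1 w))\<^sup>2" "e w"]
    have "(h (X 1 w, Y 1 w))\<^sup>2 \<le> 2 * ((Db (X 1 w))\<^sup>2 - (Da (X 1 w))\<^sup>2)\<^sup>2 + 8 * (e w)\<^sup>2"
      by (simp add: h_eq[OF that])
    moreover have "((Db (X 1 w))\<^sup>2 - (Da (X 1 w))\<^sup>2)\<^sup>2 \<le> (Db (X 1 w)) ^ 4 + (Da (X 1 w)) ^ 4"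
    proof -
      have "0 \<le> 2 * ((Db (X 1 w))\<^sup>2 * (Da (X 1 w))\<^sup>2)" by simp
      then show ?thesis by (simp add: power2_diff power_mult_distrib flip: power_mult)
    qed
    ultimately show ?thesis by simp
  qed
  have int4: "integrable \<Omega> (\<lambda>w. 2 * (Da (X 1 w)) ^ 4 + 2 * (Db (X 1 w)) ^ 4 + 8 * (e w)\<^sup>2)"
    using cov(1)[OF _ a4(1)] cov(1)[OF _ b4(1)] e2 by auto
  have inth: "integrable \<Omega> (\<lambda>w. (h (X 1 w, Y 1 w))\<^sup>2)"
    by (rule Bochner_Integration.integrable_bound[OF int4]) (use h2_le in \<open>auto intro!: AE_I2\<close>)
  have h2: "integrable Q (\<lambda>z. (h z)\<^sup>2)"
    unfolding Q_def using inth by (subst integrable_distr_eq) auto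
  have "(\<integral>z. (h z)\<^sup>2 \<partial>Q) = (\<integral>w. (h (X 1 w, Y 1 w))\<^sup>2 \<partial>\<Omega>)"
    unfolding Q_def by (subst integral_distr) auto
  also have "\<dots> \<le> (\<integral>w. 2 * (Da (X 1 w)) ^ 4 + 2 * (Db (X 1 w)) ^ 4 + 8 * (e w)\<^sup>2 \<partial>\<Omega>)"
    using inth int4 h2_le by (intro integral_mono) auto
  also have "\<dots> = 2 * (\<integral>x. (Da x) ^ 4 \<partial>P\<^sub>X) + 2 * (\<integral>x. (Db x) ^ 4 \<partial>P\<^sub>X) + 8 * (\<integral>w. (e w)\<^sup>2 \<partial>\<Omega>)"
    using cov[OF _ a4(1)] cov[OF _ b4(1)] e2 by simp
  also have "\<dots> \<le> 2 * (K * a) ^ 4 + 2 * (K * b) ^ 4 + 8 * (s * (2 * a\<^sup>2 + 2 * b\<^sup>2))"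
    using a4 b4 e2 by linarith
  \<comment> \<open>As \<open>a \<le> b\<close>, every \<open>a\<close> may be replaced by
    \<open>b\<close>, which collects the constants into 4 and 32.\<close>
  also have "\<dots> \<le> 2 * (K * b) ^ 4 + 2 * (K * b) ^ 4 + 8 * (s * (2 * b\<^sup>2 + 2 * b\<^sup>2))"
  proof -
    have "a \<le> (1 + c) * a" using ab by (simp add: algebra_simps)
    then have "a \<le> b" using ab by linarith
    then have "(K * a) ^ 4 \<le> (K * b) ^ 4" "a\<^sup>2 \<le> b\<^sup>2"
      using ab L4 by (auto intro!: power_mono mult_left_mono)
    then show ?thesis using s by (intro add_mono mult_left_mono) auto
  qed
  finally have var_le: "(\<integral>z. (h z)\<^sup>2 \<partial>Q) \<le> 4 * K ^ 4 * b ^ 4 + 32 * s * b\<^sup>2"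
    by (simp add: power_mult_distrib algebra_simps)
  \<comment> \<open>The relative gap of the mean: \<open>a \<le> b / (1 + c)\<close> gives
    \<open>b\<^sup>2 - a\<^sup>2 \<ge> k * b\<^sup>2\<close>.\<close>
  define k where "k = 1 - 1 / (1 + c)\<^sup>2"
  have k0: "k > 0" using ab one_less_power[of "1 + c" 2] by (simp add: k_def)
  have "a \<le> b / (1 + c)" using ab by (simp add: field_simps)
  then have "a\<^sup>2 \<le> (b / (1 + c))\<^sup>2" using ab by (intro power_mono) auto
  then have k_le: "k * b\<^sup>2 \<le> b\<^sup>2 - a\<^sup>2" by (simp add: k_def power_divide algebra_simps)
  have kb: "k * b\<^sup>2 > 0" using k0 ab by simp
  have cI: "card I > 0" using I by (simp add: card_gt_0_iff)
  have "measure (\<Pi>\<^sub>M i\<in>I. Q) {t \<in> space (\<Pi>\<^sub>M i\<in>I. Q). (\<Sum>i\<in>I. h (t i)) \<le> 0}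
      \<le> (\<integral>z. (h z)\<^sup>2 \<partial>Q) / (card I * (\<integral>z. h z \<partial>Q)\<^sup>2)"
    using I h2 hQ kb k_le prob_space_distr[OF observation_measurable[of 1]]
    by (intro iid_sum_nonpos_prob) (auto simp: Q_def mean[unfolded Q_def])
  also have "\<dots> \<le> (4 * K ^ 4 * b ^ 4 + 32 * s * b\<^sup>2) / (card I * (k * b\<^sup>2)\<^sup>2)"
  proof (unfold mean, intro frac_le mult_left_mono power_mono)
    show "0 \<le> 4 * K ^ 4 * b ^ 4 + 32 * s * b\<^sup>2" using L4(1) s ab(2) by simp
    show "(\<integral>z. (h z)\<^sup>2 \<partial>Q) \<le> 4 * K ^ 4 * b ^ 4 + 32 * s * b\<^sup>2" by (rule var_le)
    show "0 < card I * (k * b\<^sup>2)\<^sup>2" using cI k0 ab(2) by simp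
    show "k * b\<^sup>2 \<le> b\<^sup>2 - a\<^sup>2" by (rule k_le)
    show "0 \<le> k * b\<^sup>2" using kb by linarith
  qed simp
  also have "\<dots> = (4 * K ^ 4 + 32 * s / b\<^sup>2) / (card I * k\<^sup>2)"
  proof -
    have b4: "b ^ 4 = b\<^sup>2 * b\<^sup>2" by (simp flip: power_add)
    have num: "4 * K ^ 4 * b ^ 4 + 32 * s * b\<^sup>2 = (4 * K ^ 4 + 32 * s / b\<^sup>2) * b ^ 4"
    proof -
      have "u * (x * x) + v * x = (u + v / x) * (x * x)" if "x \<noteq> 0" for u v x :: real
        using that by (simp add: field_simps)
      from this[of "b\<^sup>2" "4 * K ^ 4" "32 * s"] show ?thesis
        unfolding b4 using ab(2) zero_less_power[OF ab(2), of 2] by linarith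
    qed
    have den: "card I * (k * b\<^sup>2)\<^sup>2 = card I * k\<^sup>2 * b ^ 4"
      unfolding b4 by (simp only: power2_eq_square mult_ac)
    have "b ^ 4 \<noteq> 0" using ab(2) by simp
    then show ?thesis unfolding num den by (rule mult_divide_mult_cancel_right)
  qed
  finally have bound: "measure (\<Pi>\<^sub>M i\<in>I. Q) {t \<in> space (\<Pi>\<^sub>M i\<in>I. Q). (\<Sum>i\<in>I. h (t i)) \<le> 0}
      \<le> (4 * K ^ 4 + 32 * s / b\<^sup>2) / (card I * k\<^sup>2)" .
  have "(\<Sum>i\<in>I. h (t i)) \<le> 0 \<longleftrightarrow>
      (\<Sum>i\<in>I. (snd (t i) - gb (fst (t i)))\<^sup>2) \<le> (\<Sum>i\<in>I. (snd (t i) - ga (fst (t i)))\<^sup>2)" for t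
    by (simp add: h_def sum_subtractf)
  then show ?thesis using bound by (simp only: k_def)
qed

end

subsection \<open>A single data split\<close>

text \<open>The i.i.d. hypotheses. The variance bound is stated at index 1, whose observation
  represents the common law.\<close>

locale iid_regression = regression_setting \<Omega> \<X> P\<^sub>X f X Y \<epsilon>
  for \<Omega> :: "'w measure" and \<X> :: "(real ^ 'd) set" and P\<^sub>X and f and X Y \<epsilon> +
  fixes \<sigma>2 :: real
  assumes observations_indep: "indep_vars (\<lambda>_. obs_space \<X>) (\<lambda>i w. (X i w, Y i w)) {1..}"
    and observations_identically_distributed:
      "i \<ge> 1 \<Longrightarrow> distr \<Omega> (obs_space \<X>) (\<lambda>w. (X i w, Y i w))
                 = distr \<Omega> (obs_space \<X>) (\<lambda>w. (X 1 w, Y 1 w))"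
    and variance_nonneg: "\<sigma>2 \<ge> 0"
    and variance_bound: "AE w in \<Omega>.
         nn_cond_exp \<Omega> (vimage_algebra (space \<Omega>) (X 1) (restrict_space borel \<X>))
           (\<lambda>w. ennreal ((\<epsilon> 1 w)\<^sup>2)) w \<le> ennreal \<sigma>2"
begin

section \<open>Laws of samples\<close>

definition obs_distr :: "((real ^ 'd) \<times> real) measure" where
  "obs_distr = distr \<Omega> (obs_space \<X>) (\<lambda>w. (X 1 w, Y 1 w))"

definition sample_distr :: "nat set \<Rightarrow> (nat \<Rightarrow> (real ^ 'd) \<times> real) measure" where
  "sample_distr I = (\<Pi>\<^sub>M i\<in>I. obs_distr)"

lemma prob_space_obs_distr: "prob_space obs_distr"
  unfolding obs_distr_def by (intro prob_space_distr observation_measurable) simp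

lemma sets_sample_distr[measurable_cong]: "sets (sample_distr I) = sets (\<Pi>\<^sub>M i\<in>I. obs_space \<X>)"
  unfolding sample_distr_def by (intro sets_PiM_cong) (auto simp: obs_distr_def)

lemma sample_measurable:
  assumes "r ` I \<subseteq> {1..}"
  shows "(\<lambda>w. \<lambda>i\<in>I. (X (r i) w, Y (r i) w)) \<in> measurable \<Omega> (\<Pi>\<^sub>M i\<in>I. obs_space \<X>)"
  using assms by (intro measurable_restrict observation_measurable) auto

text \<open>This is the exchangeability of the data, since the right-hand side is free of
  \<open>r\<close>. It serves with a permutation as \<open>r\<close> for the reordered observations
  and with \<open>id\<close> for the estimation sample.\<close>

lemma distr_sample:
  assumes "inj_on r I" "r ` I \<subseteq> {1..}"
  shows "distr \<Omega> (\<Pi>\<^sub>M i\<in>I. obs_space \<X>) (\<lambda>w. \<lambda>i\<in>I. (X (r i) w, Y (r i) w)) = sample_distr I"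
  unfolding sample_distr_def
proof (rule distr_iid_subfamily[OF observations_indep _ assms])
  show "distr \<Omega> (obs_space \<X>) (\<lambda>w. (X j w, Y j w)) = obs_distr" if "j \<in> {1..}" for j
    using observations_identically_distributed[of j] that by (simp only: obs_distr_def atLeast_iff)
qed simp

lemma sample_event:
  assumes "r ` I \<subseteq> {1..}" "B \<in> sets (\<Pi>\<^sub>M i\<in>I. obs_space \<X>)"
  shows "{w \<in> space \<Omega>. (\<lambda>i\<in>I. (X (r i) w, Y (r i) w)) \<in> B} \<in> events"
proof -
  have "{w \<in> space \<Omega>. (\<lambda>i\<in>I. (X (r i) w, Y (r i) w)) \<in> B}
      = (\<lambda>w. \<lambda>i\<in>I. (X (r i) w, Y (r i) w)) -` B \<inter> space \<Omega>" by auto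
  then show ?thesis using measurable_sets[OF sample_measurable[OF assms(1)] assms(2)] by simp
qed

lemma prob_sample:
  assumes "inj_on r I" "r ` I \<subseteq> {1..}" "B \<in> sets (\<Pi>\<^sub>M i\<in>I. obs_space \<X>)"
  shows "prob {w \<in> space \<Omega>. (\<lambda>i\<in>I. (X (r i) w, Y (r i) w)) \<in> B} = measure (sample_distr I) B"
proof -
  have "measure (sample_distr I) B
      = prob ((\<lambda>w. \<lambda>i\<in>I. (X (r i) w, Y (r i) w)) -` B \<inter> space \<Omega>)"
    unfolding distr_sample[OF assms(1,2), symmetric]
    using sample_measurable[OF assms(2)] assms(3) by (rule measure_distr)
  also have "(\<lambda>w. \<lambda>i\<in>I. (X (r i) w, Y (r i) w)) -` B \<inter> space \<Omega>
      = {w \<in> space \<Omega>. (\<lambda>i\<in>I. (X (r i) w, Y (r i) w)) \<in> B}" by auto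
  finally show ?thesis by simp
qed

section \<open>Measurability of losses and criteria\<close>

lemma estimator_error_measurable:
  assumes "regression_procedure \<X> \<delta>" "n \<ge> 1"
  shows "(\<lambda>(s, x). f x - \<delta> n s x) \<in> borel_measurable ((\<Pi>\<^sub>M i\<in>{1..n}. obs_space \<X>) \<Otimes>\<^sub>M P\<^sub>X)"
proof -
  note [measurable_cong] = sets_PX
  note [measurable] = regression_function_measurable
  have [measurable]: "(\<lambda>p. \<delta> n (fst p) (snd p)) \<in>
      borel_measurable ((\<Pi>\<^sub>M i\<in>{1..n}. obs_space \<X>) \<Otimes>\<^sub>M restrict_space borel \<X>)"
    using assms unfolding regression_procedure_def by (simp add: case_prod_unfold)
  show ?thesis unfolding case_prod_unfold by measurable
qed

text \<open>Joint measurability in the sample and the point makes the integral over the point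
  measurable in the sample, by Tonelli.\<close>

lemma Lq_error_measurable:
  assumes "regression_procedure \<X> \<delta>" "n \<ge> 1"
  shows "(\<lambda>s. Lq_norm P\<^sub>X q (\<lambda>x. f x - \<delta> n s x)) \<in> borel_measurable (\<Pi>\<^sub>M i\<in>{1..n}. obs_space \<X>)"
proof -
  interpret PX: prob_space P\<^sub>X by (rule prob_space_PX)
  note estimator_error_measurable[OF assms, measurable]
  have [measurable]: "(\<lambda>s. \<integral>\<^sup>+x. ennreal (\<bar>f x - \<delta> n s x\<bar> powr q) \<partial>P\<^sub>X)
      \<in> borel_measurable (\<Pi>\<^sub>M i\<in>{1..n}. obs_space \<X>)"
    by measurable
  show ?thesis unfolding Lq_norm_def Let_def by measurable
qed

lemma cv_criterion_measurable:
  assumes "regression_procedure \<X> \<delta>" "m \<ge> 1" "m \<le> n"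
  shows "cv_criterion n m \<delta> \<in> borel_measurable (\<Pi>\<^sub>M i\<in>{1..n}. obs_space \<X>)"
proof -
  have d: "(\<lambda>(s, x). \<delta> m s x) \<in>
      borel_measurable ((\<Pi>\<^sub>M i\<in>{1..m}. obs_space \<X>) \<Otimes>\<^sub>M restrict_space borel \<X>)"
    using assms unfolding regression_procedure_def by blast
  have z: "(\<lambda>z. z i) \<in> measurable (\<Pi>\<^sub>M i\<in>{1..n}. obs_space \<X>) (restrict_space borel \<X> \<Otimes>\<^sub>M borel)"
    if "i \<in> {m<..n}" for i
    using that measurable_component_singleton[of i "{1..n}" "\<lambda>_. obs_space \<X>"] by (simp add: obs_space_def)
  have r: "(\<lambda>z. restrict z {1..m}) \<in> measurable (\<Pi>\<^sub>M i\<in>{1..n}. obs_space \<X>) (\<Pi>\<^sub>M i\<in>{1..m}. obs_space \<X>)"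
    using assms(3) by (intro measurable_restrict_subset) auto
  have e: "(\<lambda>z. \<delta> m (restrict z {1..m}) (fst (z i))) \<in> borel_measurable (\<Pi>\<^sub>M i\<in>{1..n}. obs_space \<X>)"
    if "i \<in> {m<..n}" for i
    using measurable_compose[OF measurable_Pair[OF r measurable_compose[OF z[OF that] measurable_fst]] d]
    by simp
  show ?thesis
    unfolding cv_criterion_def
    using e measurable_compose[OF z measurable_snd] by measurable
qed

section \<open>One split, conditioned on the estimation sample\<close>

lemma estimator_measurable:
  assumes "regression_procedure \<X> \<delta>" "n \<ge> 1" "s \<in> space (\<Pi>\<^sub>M i\<in>{1..n}. obs_space \<X>)"
  shows "\<delta> n s \<in> borel_measurable (restrict_space borel \<X>)"
proof -
  have "(\<lambda>(s, x). \<delta> n s x) \<in>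
      borel_measurable ((\<Pi>\<^sub>M i\<in>{1..n}. obs_space \<X>) \<Otimes>\<^sub>M restrict_space borel \<X>)"
    using assms unfolding regression_procedure_def by blast
  from measurable_compose[OF measurable_Pair1'[OF assms(3)] this] show ?thesis by simp
qed

text \<open>The estimation samples over which one Chebyshev bound, depending on them only through
  \<open>c\<close>, \<open>u\<close> and \<open>K\<close>, holds uniformly. Finiteness is asked of
  the worse loss alone, since for \<open>c > 0\<close> the first inequality passes it on to the
  better one.\<close>

definition good_samples :: "'d procedure \<Rightarrow> 'd procedure \<Rightarrow> nat \<Rightarrow> real \<Rightarrow> real \<Rightarrow> real \<Rightarrow> (nat \<Rightarrow> (real ^ 'd) \<times> real) set"
  where
  "good_samples \<delta>a \<delta>b m c u K = {s \<in> space (\<Pi>\<^sub>M i\<in>{1..m}. obs_space \<X>).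
     L2_loss P\<^sub>X f (\<delta>b m s) \<ge> ennreal (1 + c) * L2_loss P\<^sub>X f (\<delta>a m s) \<and>
     L2_loss P\<^sub>X f (\<delta>b m s) \<ge> ennreal u \<and> L2_loss P\<^sub>X f (\<delta>b m s) < \<infinity> \<and>
     Lq_norm P\<^sub>X 4 (\<lambda>x. f x - \<delta>a m s x) / Lq_norm P\<^sub>X 2 (\<lambda>x. f x - \<delta>a m s x) \<le> ennreal K \<and>
     Lq_norm P\<^sub>X 4 (\<lambda>x. f x - \<delta>b m s x) / Lq_norm P\<^sub>X 2 (\<lambda>x. f x - \<delta>b m s x) \<le> ennreal K}"

lemma good_samples_sets:
  assumes "regression_procedure \<X> \<delta>a" "regression_procedure \<X> \<delta>b" "m \<ge> 1"
  shows "good_samples \<delta>a \<delta>b m c u K \<in> sets (\<Pi>\<^sub>M i\<in>{1..m}. obs_space \<X>)"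
  unfolding good_samples_def L2_loss_def
  by (rule sets_Collect_ratio_bounds[OF Lq_error_measurable[OF assms(1,3)] Lq_error_measurable[OF assms(2,3)]
        Lq_error_measurable[OF assms(1,3)] Lq_error_measurable[OF assms(2,3)]])

text \<open>The bound of \<open>validation_gap_prob\<close> decreases in the loss of the worse
  estimate, so that loss may be replaced by its lower bound \<open>u\<close>, which does not depend
  on the sample.\<close>

lemma good_sample_gap_prob:
  assumes proc: "regression_procedure \<X> \<delta>a" "regression_procedure \<X> \<delta>b" and m: "m \<ge> 1"
    and pos: "c > 0" "u > 0" "K \<ge> 0" and I: "finite I" "I \<noteq> {}"
    and s: "s \<in> good_samples \<delta>a \<delta>b m c u K"
  shows "measure (sample_distr I) {t \<in> space (sample_distr I).
      (\<Sum>i\<in>I. (snd (t i) - \<delta>b m s (fst (t i)))\<^sup>2) \<le> (\<Sum>i\<in>I. (snd (t i) - \<delta>a m s (fst (t i)))\<^sup>2)}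
    \<le> (4 * K ^ 4 + 32 * \<sigma>2 / u\<^sup>2) / (card I * (1 - 1 / (1 + c)\<^sup>2)\<^sup>2)"
proof -
  let ?La = "L2_loss P\<^sub>X f (\<delta>a m s)" and ?Lb = "L2_loss P\<^sub>X f (\<delta>b m s)"
  have sp: "s \<in> space (\<Pi>\<^sub>M i\<in>{1..m}. obs_space \<X>)"
    and better: "ennreal (1 + c) * ?La \<le> ?Lb" and low: "ennreal u \<le> ?Lb" and fin: "?Lb < \<infinity>"
    and ra: "Lq_norm P\<^sub>X 4 (\<lambda>x. f x - \<delta>a m s x) / ?La \<le> ennreal K"
    and rb: "Lq_norm P\<^sub>X 4 (\<lambda>x. f x - \<delta>b m s x) / ?Lb \<le> ennreal K"
    using s by (auto simp: good_samples_def L2_loss_def)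
  define a where "a = enn2real ?La"
  define b where "b = enn2real ?Lb"
  \<comment> \<open>An infinite \<open>?La\<close>, multiplied by the positive number
    \<open>1 + c\<close>, would make \<open>?Lb\<close> infinite.\<close>
  have "?La \<noteq> \<infinity>"
    using better fin pos by (auto simp: ennreal_mult_top)
  then have a: "?La = ennreal a" "a \<ge> 0" by (auto simp: a_def less_top)
  have b: "?Lb = ennreal b" "b \<ge> 0" using fin by (auto simp: b_def)
  have ub: "u \<le> b" using low b pos by (simp add: ennreal_le_iff)
  have ab: "(1 + c) * a \<le> b"
    using better a b pos by (simp add: ennreal_mult[symmetric] ennreal_le_iff del: ennreal_plus)
  have L4: "Lq_norm P\<^sub>X 4 (\<lambda>x. f x - \<delta>a m s x) \<le> ennreal (K * a)"
    "Lq_norm P\<^sub>X 4 (\<lambda>x. f x - \<delta>b m s x) \<le> ennreal (K * b)"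
    using ra rb a b pos by (auto intro: ennreal_le_mult_of_divide_le)
  have "measure (sample_distr I) {t \<in> space (sample_distr I).
      (\<Sum>i\<in>I. (snd (t i) - \<delta>b m s (fst (t i)))\<^sup>2) \<le> (\<Sum>i\<in>I. (snd (t i) - \<delta>a m s (fst (t i)))\<^sup>2)}
    \<le> (4 * K ^ 4 + 32 * \<sigma>2 / b\<^sup>2) / (card I * (1 - 1 / (1 + c)\<^sup>2)\<^sup>2)"
    unfolding sample_distr_def obs_distr_def
    using estimator_measurable[OF proc(1) m sp] estimator_measurable[OF proc(2) m sp]
      a b ab ub pos L4 I variance_nonneg variance_bound
    by (intro validation_gap_prob) auto
  also have "\<dots> \<le> (4 * K ^ 4 + 32 * \<sigma>2 / u\<^sup>2) / (card I * (1 - 1 / (1 + c)\<^sup>2)\<^sup>2)"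
    using ub pos variance_nonneg
    by (intro divide_right_mono add_left_mono divide_left_mono power_mono mult_pos_pos) auto
  finally show ?thesis .
qed

text \<open>Ties count as wrong votes, so the same set serves whichever procedure is the better one,
  although \<open>cv_vote\<close> breaks ties in favour of the first.\<close>

definition wrong_votes :: "'d procedure \<Rightarrow> 'd procedure \<Rightarrow> nat \<Rightarrow> nat \<Rightarrow> (nat \<Rightarrow> (real ^ 'd) \<times> real) set" where
  "wrong_votes \<delta>a \<delta>b n m = {z \<in> space (\<Pi>\<^sub>M i\<in>{1..n}. obs_space \<X>).
     cv_criterion n m \<delta>b z \<le> cv_criterion n m \<delta>a z}"

lemma wrong_votes_sets:
  assumes "regression_procedure \<X> \<delta>a" "regression_procedure \<X> \<delta>b" "m \<ge> 1" "m \<le> n"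
  shows "wrong_votes \<delta>a \<delta>b n m \<in> sets (\<Pi>\<^sub>M i\<in>{1..n}. obs_space \<X>)"
  unfolding wrong_votes_def
  using cv_criterion_measurable[OF assms(1,3,4)] cv_criterion_measurable[OF assms(2,3,4)] by measurable

text \<open>Fubini over the estimation and the validation part: the first summand pays for bad
  estimation samples, the second is the Chebyshev bound on the good ones.\<close>

lemma wrong_votes_prob:
  assumes proc: "regression_procedure \<X> \<delta>a" "regression_procedure \<X> \<delta>b" and m: "m \<ge> 1" "m < n"
    and pos: "c > 0" "u > 0" "K \<ge> 0"
  shows "measure (sample_distr {1..n}) (wrong_votes \<delta>a \<delta>b n m)
    \<le> (1 - measure (sample_distr {1..m}) (good_samples \<delta>a \<delta>b m c u K))
      + (4 * K ^ 4 + 32 * \<sigma>2 / u\<^sup>2) / (real (n - m) * (1 - 1 / (1 + c)\<^sup>2)\<^sup>2)"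
proof -
  let ?I = "{1..m}" and ?J = "{m<..n}"
  have un: "?I \<union> ?J = {1..n}" and disj: "?I \<inter> ?J = {}" using m by auto
  let ?B = "wrong_votes \<delta>a \<delta>b n m" and ?G = "good_samples \<delta>a \<delta>b m c u K"
  let ?eta = "(4 * K ^ 4 + 32 * \<sigma>2 / u\<^sup>2) / (real (n - m) * (1 - 1 / (1 + c)\<^sup>2)\<^sup>2)"
  have sp: "space (sample_distr I) = space (\<Pi>\<^sub>M i\<in>I. obs_space \<X>)" for I
    by (rule sets_eq_imp_space_eq[OF sets_sample_distr])
  have "measure (\<Pi>\<^sub>M i\<in>?I \<union> ?J. obs_distr) ?B \<le> (1 - measure (\<Pi>\<^sub>M i\<in>?I. obs_distr) ?G) + ?eta"
  proof (rule measure_PiM_Un_le[OF prob_space_obs_distr _ _ disj])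
    show "?G \<in> sets (\<Pi>\<^sub>M i\<in>?I. obs_distr)"
      using good_samples_sets[OF proc m(1)] sets_sample_distr by (simp add: sample_distr_def)
    show "?B \<in> sets (\<Pi>\<^sub>M i\<in>?I \<union> ?J. obs_distr)"
      unfolding un using wrong_votes_sets[OF proc m(1)] m sets_sample_distr by (simp add: sample_distr_def)
    show "0 \<le> ?eta" using variance_nonneg pos by simp
    fix s assume s: "s \<in> ?G"
    then have s': "s \<in> space (\<Pi>\<^sub>M i\<in>?I. obs_space \<X>)" by (simp add: good_samples_def)
    \<comment> \<open>Merging leaves the estimation part equal to \<open>s\<close>. The fitted
      functions are thereby fixed, and the criterion becomes a sum over the independent coordinates
      of \<open>t\<close>.\<close>
    then have ext: "restrict (merge ?I ?J (s, t)) ?I = s" for t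
      using disj by (simp add: space_PiM PiE_def extensional_restrict del: One_nat_def)
    have val: "cv_criterion n m \<delta> (merge ?I ?J (s, t)) = (\<Sum>i\<in>?J. (snd (t i) - \<delta> m s (fst (t i)))\<^sup>2)"
      for \<delta> :: "'d procedure" and t
      unfolding cv_criterion_def ext by (intro sum.cong) (auto simp: merge_def)
    have mono: "{t \<in> space (sample_distr ?J). merge ?I ?J (s, t) \<in> ?B}
      = {t \<in> space (sample_distr ?J). (\<Sum>i\<in>?J. (snd (t i) - \<delta>b m s (fst (t i)))\<^sup>2)
           \<le> (\<Sum>i\<in>?J. (snd (t i) - \<delta>a m s (fst (t i)))\<^sup>2)}"
    proof -
      have "merge ?I ?J (s, t) \<in> space (\<Pi>\<^sub>M i\<in>{1..n}. obs_space \<X>)"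
        if "t \<in> space (sample_distr ?J)" for t
        using that s' unfolding sp un[symmetric] space_PiM using disj by (auto simp: PiE_cancel_merge)
      then have "merge ?I ?J (s, t) \<in> ?B \<longleftrightarrow> (\<Sum>i\<in>?J. (snd (t i) - \<delta>b m s (fst (t i)))\<^sup>2)
           \<le> (\<Sum>i\<in>?J. (snd (t i) - \<delta>a m s (fst (t i)))\<^sup>2)"
        if "t \<in> space (sample_distr ?J)" for t
        using that unfolding wrong_votes_def by (simp only: mem_Collect_eq val simp_thms)
      then show ?thesis by blast
    qed
    show "measure (\<Pi>\<^sub>M i\<in>?J. obs_distr) {t \<in> space (\<Pi>\<^sub>M i\<in>?J. obs_distr). merge ?I ?J (s, t) \<in> ?B} \<le> ?eta"
    proof -
      have "measure (sample_distr ?J) {t \<in> space (sample_distr ?J). merge ?I ?J (s, t) \<in> ?B}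
          \<le> (4 * K ^ 4 + 32 * \<sigma>2 / u\<^sup>2) / (real (card ?J) * (1 - 1 / (1 + c)\<^sup>2)\<^sup>2)"
        unfolding mono using m by (intro good_sample_gap_prob[OF proc m(1) pos _ _ s]) auto
      then show ?thesis unfolding sample_distr_def by simp
    qed
  qed auto
  then show ?thesis unfolding un by (simp add: sample_distr_def)
qed

end

subsection \<open>Voting over permutations\<close>

text \<open>Lets the observation sequence, defined at every index, be replaced by its restriction to
  \<open>{1..n}\<close>, which is an element of the product space.\<close>

lemma cv_criterion_cong:
  assumes "\<And>i. i \<in> {1..n} \<Longrightarrow> z i = z' i" "m \<le> n"
  shows "cv_criterion n m \<delta> z = cv_criterion n m \<delta> z'"
proof -
  have "restrict z {1..m} = restrict z' {1..m}"
    using assms by (auto simp: restrict_def fun_eq_iff)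
  then show ?thesis
    unfolding cv_criterion_def using assms by (intro sum.cong) auto
qed

lemma sum_cv_vote:
  "(\<Sum>\<pi> | \<pi> permutes {1..n}. cv_vote n m \<delta>\<^sub>1 \<delta>\<^sub>2 (z \<circ> \<pi>))
    = card {\<pi>. \<pi> permutes {1..n} \<and> cv_criterion n m \<delta>\<^sub>1 (z \<circ> \<pi>) \<le> cv_criterion n m \<delta>\<^sub>2 (z \<circ> \<pi>)}"
  by (simp add: cv_vote_def sum.If_cases finite_permutations Int_def)

text \<open>Here \<open>k\<close> is the number of the better procedure \<open>\<delta>a\<close>.
  The inequality is not strict because an even split selects the first procedure, which is the wrong
  choice for \<open>k = 2\<close>.\<close>

lemma wrong_selection_majority:
  assumes "k = 1 \<and> \<delta>a = \<delta>\<^sub>1 \<and> \<delta>b = \<delta>\<^sub>2 \<or> k = 2 \<and> \<delta>a = \<delta>\<^sub>2 \<and> \<delta>b = \<delta>\<^sub>1"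
    and wrong: "cvv_select n m \<delta>\<^sub>1 \<delta>\<^sub>2 z \<noteq> k"
  shows "card {\<pi>. \<pi> permutes {1..n}}
    \<le> 2 * card {\<pi> \<in> {\<pi>. \<pi> permutes {1..n}}. cv_criterion n m \<delta>b (z \<circ> \<pi>) \<le> cv_criterion n m \<delta>a (z \<circ> \<pi>)}"
proof -
  let ?S = "{\<pi>. \<pi> permutes {1..n}}"
  let ?V = "\<lambda>\<delta> \<delta>'. {\<pi> \<in> ?S. cv_criterion n m \<delta> (z \<circ> \<pi>) \<le> cv_criterion n m \<delta>' (z \<circ> \<pi>)}"
  have fin: "finite ?S" by (rule finite_permutations) simp
  have S: "card ?S = fact n" by (simp add: card_permutations)
  have sel: "cvv_select n m \<delta>\<^sub>1 \<delta>\<^sub>2 z = (if real (card (?V \<delta>\<^sub>1 \<delta>\<^sub>2)) \<ge> fact n / 2 then 1 else 2)"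
    unfolding cvv_select_def sum_cv_vote by simp
  from assms(1) show ?thesis
  proof
    assume k: "k = 1 \<and> \<delta>a = \<delta>\<^sub>1 \<and> \<delta>b = \<delta>\<^sub>2"
    then have "real (card (?V \<delta>\<^sub>1 \<delta>\<^sub>2)) < fact n / 2" using wrong sel by (auto split: if_splits)
    then have "real (2 * card (?V \<delta>\<^sub>1 \<delta>\<^sub>2)) \<le> real (card ?S)" using S by simp
    then have "2 * card (?V \<delta>\<^sub>1 \<delta>\<^sub>2) \<le> card ?S" by (simp only: of_nat_le_iff)
    \<comment> \<open>Of two real criteria one is at most the other, so every permutation lies in at
      least one of the two sets. Fewer than half in the first leaves at least half in the
      second.\<close>
    moreover have "card ?S \<le> card (?V \<delta>\<^sub>1 \<delta>\<^sub>2) + card (?V \<delta>\<^sub>2 \<delta>\<^sub>1)"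
    proof -
      have "?S \<subseteq> ?V \<delta>\<^sub>1 \<delta>\<^sub>2 \<union> ?V \<delta>\<^sub>2 \<delta>\<^sub>1" by auto
      then have "card ?S \<le> card (?V \<delta>\<^sub>1 \<delta>\<^sub>2 \<union> ?V \<delta>\<^sub>2 \<delta>\<^sub>1)" using fin by (intro card_mono) auto
      also have "\<dots> \<le> card (?V \<delta>\<^sub>1 \<delta>\<^sub>2) + card (?V \<delta>\<^sub>2 \<delta>\<^sub>1)" by (rule card_Un_le)
      finally show ?thesis .
    qed
    ultimately show ?thesis using k by simp
  next
    assume k: "k = 2 \<and> \<delta>a = \<delta>\<^sub>2 \<and> \<delta>b = \<delta>\<^sub>1"
    \<comment> \<open>Now the votes for the first procedure are the wrong ones, and the threshold
      \<open>fact n / 2\<close> of the selection rule is already the required bound.\<close>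
    then have "real (card (?V \<delta>\<^sub>1 \<delta>\<^sub>2)) \<ge> fact n / 2" using wrong sel by (auto split: if_splits)
    then have "real (card ?S) \<le> real (2 * card (?V \<delta>\<^sub>1 \<delta>\<^sub>2))" using S by simp
    then show ?thesis using k by (simp only: of_nat_le_iff)
  qed
qed

context iid_regression
begin

text \<open>The reordered sample has the law of the original one, so the probability of a wrong vote
  is the same for every \<pi>.\<close>

lemma permuted_criteria_event:
  assumes proc: "regression_procedure \<X> \<delta>a" "regression_procedure \<X> \<delta>b" and m: "m \<ge> 1" "m \<le> n"
    and p: "\<pi> permutes {1..n}"
  defines "E \<equiv> {w \<in> space \<Omega>. cv_criterion n m \<delta>b ((\<lambda>i. (X i w, Y i w)) \<circ> \<pi>)
      \<le> cv_criterion n m \<delta>a ((\<lambda>i. (X i w, Y i w)) \<circ> \<pi>)}"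
  shows "E \<in> events" "prob E = measure (sample_distr {1..n}) (wrong_votes \<delta>a \<delta>b n m)"
proof -
  let ?s = "\<lambda>w. \<lambda>i\<in>{1..n}. (X (\<pi> i) w, Y (\<pi> i) w)"
  have r: "inj_on \<pi> {1..n}" "\<pi> ` {1..n} \<subseteq> {1..}"
    using permutes_inj[OF p] permutes_image[OF p] by (auto intro: inj_on_subset)
  have crit: "cv_criterion n m \<delta> ((\<lambda>i. (X i w, Y i w)) \<circ> \<pi>) = cv_criterion n m \<delta> (?s w)" for \<delta> :: "'d procedure" and w
    using m by (intro cv_criterion_cong) auto
  have "?s w \<in> space (\<Pi>\<^sub>M i\<in>{1..n}. obs_space \<X>)" if "w \<in> space \<Omega>" for w
    using sample_measurable[OF r(2)] that by (rule measurable_space)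
  then have E: "E = {w \<in> space \<Omega>. ?s w \<in> wrong_votes \<delta>a \<delta>b n m}"
    unfolding E_def crit wrong_votes_def by blast
  show "prob E = measure (sample_distr {1..n}) (wrong_votes \<delta>a \<delta>b n m)"
    unfolding E using r wrong_votes_sets[OF proc m] by (rule prob_sample)
  show "E \<in> events"
    unfolding E using r(2) wrong_votes_sets[OF proc m] by (rule sample_event)
qed

text \<open>The voting inequality with the permutations as voters: all of them err with the same
  probability, and a wrong selection requires at least half of them to err.\<close>

lemma selection_prob_ge:
  assumes proc: "regression_procedure \<X> \<delta>\<^sub>1" "regression_procedure \<X> \<delta>\<^sub>2" and m: "m \<ge> 1" "m \<le> n"
    and k: "k = 1 \<and> \<delta>a = \<delta>\<^sub>1 \<and> \<delta>b = \<delta>\<^sub>2 \<or> k = 2 \<and> \<delta>a = \<delta>\<^sub>2 \<and> \<delta>b = \<delta>\<^sub>1"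
  shows "prob {w \<in> space \<Omega>. cvv_select n m \<delta>\<^sub>1 \<delta>\<^sub>2 (\<lambda>i. (X i w, Y i w)) = k}
    \<ge> 1 - 2 * measure (sample_distr {1..n}) (wrong_votes \<delta>a \<delta>b n m)"
proof -
  let ?z = "\<lambda>w i. (X i w, Y i w)"
  let ?S = "{\<pi>. \<pi> permutes {1..n}}"
  let ?C = "{w \<in> space \<Omega>. cvv_select n m \<delta>\<^sub>1 \<delta>\<^sub>2 (?z w) = k}"
  define B where "B \<pi> = {w \<in> space \<Omega>. cv_criterion n m \<delta>b (?z w \<circ> \<pi>) \<le> cv_criterion n m \<delta>a (?z w \<circ> \<pi>)}" for \<pi>
  have procab: "regression_procedure \<X> \<delta>a" "regression_procedure \<X> \<delta>b" using proc k by auto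
  have C: "?C \<in> events"
  proof -
    \<comment> \<open>The vote count is a finite sum of indicators of events, hence a random
      variable.\<close>
    have [measurable]: "(\<lambda>w. real (\<Sum>\<pi> | \<pi> permutes {1..n}. cv_vote n m \<delta>\<^sub>1 \<delta>\<^sub>2 (?z w \<circ> \<pi>))) \<in> borel_measurable \<Omega>"
      unfolding of_nat_sum
    proof (rule borel_measurable_sum)
      fix \<pi> assume "\<pi> \<in> ?S"
      then have [measurable]: "{w \<in> space \<Omega>. cv_criterion n m \<delta>\<^sub>1 (?z w \<circ> \<pi>) \<le> cv_criterion n m \<delta>\<^sub>2 (?z w \<circ> \<pi>)} \<in> events"
        using permuted_criteria_event(1)[OF proc(2,1) m] by blast
      have "(\<lambda>w. real (if cv_criterion n m \<delta>\<^sub>1 (?z w \<circ> \<pi>) \<le> cv_criterion n m \<delta>\<^sub>2 (?z w \<circ> \<pi>) then 1 else 0))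
          \<in> borel_measurable \<Omega>"
        by measurable
      then show "(\<lambda>w. real (cv_vote n m \<delta>\<^sub>1 \<delta>\<^sub>2 (?z w \<circ> \<pi>))) \<in> borel_measurable \<Omega>"
        unfolding cv_vote_def .
    qed
    show ?thesis unfolding cvv_select_def by measurable
  qed
  show ?thesis
  proof (rule prob_majority_ge[OF _ _ _ _ C])
    show "finite ?S" "?S \<noteq> {}"
      using permutes_id[of "{1..n}"] by (simp add: finite_permutations, blast)
    show "B \<pi> \<in> events" "prob (B \<pi>) \<le> measure (sample_distr {1..n}) (wrong_votes \<delta>a \<delta>b n m)"
      if "\<pi> \<in> ?S" for \<pi>
      using permuted_criteria_event[OF procab m, of \<pi>] that by (simp_all add: B_def)
    fix w assume w: "w \<in> space \<Omega> - ?C"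
    then have "cvv_select n m \<delta>\<^sub>1 \<delta>\<^sub>2 (?z w) \<noteq> k" by blast
    from wrong_selection_majority[OF k this] w
    show "card ?S \<le> 2 * card {\<pi> \<in> ?S. w \<in> B \<pi>}" by (simp add: B_def)
  qed
qed

text \<open>A union bound over six events of probability at least \<open>1 - e\<close>: the gap
  between the losses, a lower bound for each loss, an upper bound for the worse loss, and the two
  norm ratios.\<close>

lemma good_samples_prob_ge:
  assumes proc: "regression_procedure \<X> \<delta>a" "regression_procedure \<X> \<delta>b" and m: "m \<ge> 1"
    and e: "0 < e" "e < 1" and pos: "c > 0" "ra > 0" "rb > 0" "Kb > 0" "pm > 0" "qm > 0" "Mm > 0"
    and better: "prob {w \<in> space \<Omega>. L2_loss P\<^sub>X f (estimator X Y \<delta>b m w)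
        \<ge> ennreal (1 + c) * L2_loss P\<^sub>X f (estimator X Y \<delta>a m w)} \<ge> 1 - e"
    and low: "prob {w \<in> space \<Omega>. L2_loss P\<^sub>X f (estimator X Y \<delta>a m w) \<ge> ennreal (ra * pm)} \<ge> 1 - e"
      "prob {w \<in> space \<Omega>. L2_loss P\<^sub>X f (estimator X Y \<delta>b m w) \<ge> ennreal (rb * qm)} \<ge> 1 - e"
    and up: "prob {w \<in> space \<Omega>. L2_loss P\<^sub>X f (estimator X Y \<delta>b m w) \<le> ennreal (Kb * qm)} \<ge> 1 - e"
    and ratio: "prob {w \<in> space \<Omega>. Lq_norm P\<^sub>X 4 (\<lambda>x. f x - estimator X Y \<delta>a m w x)
          / Lq_norm P\<^sub>X 2 (\<lambda>x. f x - estimator X Y \<delta>a m w x) \<le> ennreal (K1 * Mm)} \<ge> 1 - e"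
      "prob {w \<in> space \<Omega>. Lq_norm P\<^sub>X 4 (\<lambda>x. f x - estimator X Y \<delta>b m w x)
          / Lq_norm P\<^sub>X 2 (\<lambda>x. f x - estimator X Y \<delta>b m w x) \<le> ennreal (K2 * Mm)} \<ge> 1 - e"
  shows "measure (sample_distr {1..m})
      (good_samples \<delta>a \<delta>b m c (min ra rb * max pm qm) (max K1 K2 * Mm)) \<ge> 1 - 6 * e"
proof -
  let ?G = "good_samples \<delta>a \<delta>b m c (min ra rb * max pm qm) (max K1 K2 * Mm)"
  let ?s = "\<lambda>w. \<lambda>i\<in>{1..m}. (X i w, Y i w)"
  \<comment> \<open>\<open>measure\<close> is 0 on sets outside the sigma-algebra, so a set with
    probability at least \<open>1 - e > 0\<close> must be an event.\<close>
  have ev: "A \<in> events" if "prob A \<ge> 1 - e" for A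
    using that e measure_notin_sets[of A \<Omega>] by force
  have sp: "?s w \<in> space (\<Pi>\<^sub>M i\<in>{1..m}. obs_space \<X>)" if "w \<in> space \<Omega>" for w
    using measurable_space[OF sample_measurable[of id "{1..m}"] that] by simp
  have step: "prob (A \<inter> B) \<ge> 1 - (e + b) \<and> A \<inter> B \<in> events"
    if "prob A \<ge> 1 - e" "prob B \<ge> 1 - b \<and> B \<in> events" for A B b
    using that ev[OF that(1)] prob_Int_ge by blast
  define I where "I = {w \<in> space \<Omega>. L2_loss P\<^sub>X f (estimator X Y \<delta>b m w)
        \<ge> ennreal (1 + c) * L2_loss P\<^sub>X f (estimator X Y \<delta>a m w)} \<inter>
     ({w \<in> space \<Omega>. L2_loss P\<^sub>X f (estimator X Y \<delta>a m w) \<ge> ennreal (ra * pm)} \<inter>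
     ({w \<in> space \<Omega>. L2_loss P\<^sub>X f (estimator X Y \<delta>b m w) \<ge> ennreal (rb * qm)} \<inter>
     ({w \<in> space \<Omega>. L2_loss P\<^sub>X f (estimator X Y \<delta>b m w) \<le> ennreal (Kb * qm)} \<inter>
     ({w \<in> space \<Omega>. Lq_norm P\<^sub>X 4 (\<lambda>x. f x - estimator X Y \<delta>a m w x)
          / Lq_norm P\<^sub>X 2 (\<lambda>x. f x - estimator X Y \<delta>a m w x) \<le> ennreal (K1 * Mm)} \<inter>
      {w \<in> space \<Omega>. Lq_norm P\<^sub>X 4 (\<lambda>x. f x - estimator X Y \<delta>b m w x)
          / Lq_norm P\<^sub>X 2 (\<lambda>x. f x - estimator X Y \<delta>b m w x) \<le> ennreal (K2 * Mm)}))))"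
  have "prob I \<ge> 1 - (e + (e + (e + (e + (e + e)))))"
    unfolding I_def
    using step[OF better step[OF low(1) step[OF low(2) step[OF up step[OF ratio(1) conjI[OF ratio(2) ev[OF ratio(2)]]]]]]]
    by (rule conjunct1)
  also have "prob I \<le> prob {w \<in> space \<Omega>. ?s w \<in> ?G}"
  proof (rule finite_measure_mono)
    show "{w \<in> space \<Omega>. ?s w \<in> ?G} \<in> events"
      using sample_event[of id "{1..m}" ?G] good_samples_sets[OF proc m] by simp
    show "I \<subseteq> {w \<in> space \<Omega>. ?s w \<in> ?G}"
    proof
      fix w assume "w \<in> I"
      then have w: "w \<in> space \<Omega>"
        and b: "ennreal (1 + c) * L2_loss P\<^sub>X f (\<delta>a m (?s w)) \<le> L2_loss P\<^sub>X f (\<delta>b m (?s w))"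
        and l: "ennreal (ra * pm) \<le> L2_loss P\<^sub>X f (\<delta>a m (?s w))" "ennreal (rb * qm) \<le> L2_loss P\<^sub>X f (\<delta>b m (?s w))"
        and u: "L2_loss P\<^sub>X f (\<delta>b m (?s w)) \<le> ennreal (Kb * qm)"
        and r: "Lq_norm P\<^sub>X 4 (\<lambda>x. f x - \<delta>a m (?s w) x) / Lq_norm P\<^sub>X 2 (\<lambda>x. f x - \<delta>a m (?s w) x) \<le> ennreal (K1 * Mm)"
          "Lq_norm P\<^sub>X 4 (\<lambda>x. f x - \<delta>b m (?s w) x) / Lq_norm P\<^sub>X 2 (\<lambda>x. f x - \<delta>b m (?s w) x) \<le> ennreal (K2 * Mm)"
        unfolding I_def estimator_def by blast+
      \<comment> \<open>The worse loss dominates the better one and inherits its lower bound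
        \<open>ra * pm\<close>. Together with \<open>rb * qm\<close> this gives a lower bound by the
        larger of the two rates, with the smaller of the two constants.\<close>
      have "L2_loss P\<^sub>X f (\<delta>a m (?s w)) = ennreal 1 * L2_loss P\<^sub>X f (\<delta>a m (?s w))" by simp
      also have "\<dots> \<le> ennreal (1 + c) * L2_loss P\<^sub>X f (\<delta>a m (?s w))"
        using pos by (intro mult_right_mono ennreal_leI) auto
      also note b
      finally have l': "ennreal (ra * pm) \<le> L2_loss P\<^sub>X f (\<delta>b m (?s w))" using l(1) by (rule order_trans[rotated])
      have "min ra rb * max pm qm \<le> max (ra * pm) (rb * qm)"
      proof -
        have "min ra rb * pm \<le> ra * pm" "min ra rb * qm \<le> rb * qm"
          using pos by (auto intro: mult_right_mono)
        then show ?thesis by (auto simp: max_def)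
      qed
      then have "min ra rb * max pm qm \<le> ra * pm \<or> min ra rb * max pm qm \<le> rb * qm"
        by (simp only: le_max_iff_disj)
      then have l2: "ennreal (min ra rb * max pm qm) \<le> L2_loss P\<^sub>X f (\<delta>b m (?s w))"
        using order_trans[OF ennreal_leI l'] order_trans[OF ennreal_leI l(2)] by blast
      have fin: "L2_loss P\<^sub>X f (\<delta>b m (?s w)) < \<infinity>"
        using le_less_trans[OF u ennreal_less_top] by simp
      have "ennreal (K1 * Mm) \<le> ennreal (max K1 K2 * Mm)" "ennreal (K2 * Mm) \<le> ennreal (max K1 K2 * Mm)"
        using pos by (auto intro!: ennreal_leI mult_right_mono)
      then show "w \<in> {w \<in> space \<Omega>. ?s w \<in> ?G}"
        unfolding good_samples_def using w sp[OF w] b l2 fin order_trans[OF r(1)] order_trans[OF r(2)]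
        by blast
    qed
  qed
  also have "\<dots> = measure (sample_distr {1..m}) ?G"
    using prob_sample[of id "{1..m}" ?G] good_samples_sets[OF proc m] by simp
  finally show ?thesis by simp
qed

section \<open>Limits along the data splitting\<close>

lemma wrong_votes_prob_tendsto_0:
  assumes proc: "regression_procedure \<X> \<delta>a" "regression_procedure \<X> \<delta>b"
    and ratea: "converges_exactly_at_rate \<Omega> (L2_loss P\<^sub>X) f (estimator X Y \<delta>a) p"
    and rateb: "converges_exactly_at_rate \<Omega> (L2_loss P\<^sub>X) f (estimator X Y \<delta>b) q"
    and better: "asymptotically_better \<Omega> (L2_loss P\<^sub>X) f (estimator X Y \<delta>a) (estimator X Y \<delta>b)"
    and M: "\<And>n. n \<ge> 1 \<Longrightarrow> M n > 0"
    and ratio: "\<And>\<delta>. \<delta> \<in> {\<delta>a, \<delta>b} \<Longrightarrow>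
         bigo_prob \<Omega> (\<lambda>n w. Lq_norm P\<^sub>X 4 (\<lambda>x. f x - estimator X Y \<delta> n w x)
                              / Lq_norm P\<^sub>X 2 (\<lambda>x. f x - estimator X Y \<delta> n w x)) M"
    and splitting: "\<And>n. n \<ge> 1 \<Longrightarrow> n = n\<^sub>1 n + n\<^sub>2 n"
    and n1: "filterlim n\<^sub>1 at_top sequentially" and n2: "filterlim n\<^sub>2 at_top sequentially"
    and lim4: "filterlim (\<lambda>n. real (n\<^sub>2 n) / M (n\<^sub>1 n) ^ 4) at_top sequentially"
    and lim2: "filterlim (\<lambda>n. sqrt (real (n\<^sub>2 n)) * max (p (n\<^sub>1 n)) (q (n\<^sub>1 n))) at_top sequentially"
  shows "(\<lambda>n. measure (sample_distr {1..n}) (wrong_votes \<delta>a \<delta>b n (n\<^sub>1 n))) \<longlonglongrightarrow> 0"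
proof (rule order_tendstoI)
  fix y :: real assume "y < 0"
  then show "\<forall>\<^sub>F n in sequentially. y < measure (sample_distr {1..n}) (wrong_votes \<delta>a \<delta>b n (n\<^sub>1 n))"
    by (intro always_eventually allI) (rule less_le_trans[OF _ measure_nonneg])
next
  fix y :: real assume y: "0 < y"
  \<comment> \<open>Bad estimation samples will cost at most \<open>6 * e\<close> and the Chebyshev
    term less than \<open>e\<close>, in total less than \<open>8 * e\<close>. The cap
    \<open>1 / 2\<close> keeps \<open>e\<close> below 1.\<close>
  define e where "e = min (y / 8) (1 / 2)"
  have e: "0 < e" "e < 1" "8 * e \<le> y" using y by (auto simp: e_def)
  then have eI: "e \<in> {0<..<1}" by simp
  obtain c where c: "c > 0" and evc: "\<forall>\<^sub>F n in sequentially. prob {w \<in> space \<Omega>. L2_loss P\<^sub>X f (estimator X Y \<delta>b n w)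
        \<ge> ennreal (1 + c) * L2_loss P\<^sub>X f (estimator X Y \<delta>a n w)} \<ge> 1 - e"
    using better eI unfolding asymptotically_better_def by blast
  obtain ra where ra: "ra > 0" and evra: "\<forall>\<^sub>F n in sequentially.
      prob {w \<in> space \<Omega>. L2_loss P\<^sub>X f (estimator X Y \<delta>a n w) \<ge> ennreal (ra * p n)} \<ge> 1 - e"
    using ratea eI unfolding converges_exactly_at_rate_def by blast
  obtain rb where rb: "rb > 0" and evrb: "\<forall>\<^sub>F n in sequentially.
      prob {w \<in> space \<Omega>. L2_loss P\<^sub>X f (estimator X Y \<delta>b n w) \<ge> ennreal (rb * q n)} \<ge> 1 - e"
    using rateb eI unfolding converges_exactly_at_rate_def by blast
  obtain Kb where Kb: "Kb > 0" and evKb: "\<forall>\<^sub>F n in sequentially.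
      prob {w \<in> space \<Omega>. L2_loss P\<^sub>X f (estimator X Y \<delta>b n w) \<le> ennreal (Kb * q n)} \<ge> 1 - e"
    using rateb eI unfolding converges_exactly_at_rate_def bigo_prob_def by blast
  obtain K1 where K1: "K1 > 0" and evK1: "\<forall>\<^sub>F n in sequentially.
      prob {w \<in> space \<Omega>. Lq_norm P\<^sub>X 4 (\<lambda>x. f x - estimator X Y \<delta>a n w x)
          / Lq_norm P\<^sub>X 2 (\<lambda>x. f x - estimator X Y \<delta>a n w x) \<le> ennreal (K1 * M n)} \<ge> 1 - e"
    using ratio[of \<delta>a] eI unfolding bigo_prob_def by blast
  obtain K2 where K2: "K2 > 0" and evK2: "\<forall>\<^sub>F n in sequentially.
      prob {w \<in> space \<Omega>. Lq_norm P\<^sub>X 4 (\<lambda>x. f x - estimator X Y \<delta>b n w x)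
          / Lq_norm P\<^sub>X 2 (\<lambda>x. f x - estimator X Y \<delta>b n w x) \<le> ennreal (K2 * M n)} \<ge> 1 - e"
    using ratio[of \<delta>b] eI unfolding bigo_prob_def by blast
  have pq: "p n > 0" "q n > 0" if "n \<ge> 1" for n
    using ratea rateb that unfolding converges_exactly_at_rate_def by blast+
  define K where "K = max K1 K2"
  define r where "r = min ra rb"
  define \<kappa> where "\<kappa> = (1 - 1 / (1 + c)\<^sup>2)\<^sup>2"
  define mx where "mx n = max (p (n\<^sub>1 n)) (q (n\<^sub>1 n))" for n
  define bd where "bd n = (4 * (K * M (n\<^sub>1 n)) ^ 4 + 32 * \<sigma>2 / (r * mx n)\<^sup>2) / (real (n\<^sub>2 n) * \<kappa>)" for n
  \<comment> \<open>The two summands are constant multiples of inverse powers of the quantities that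
    diverge by \<open>lim4\<close> and \<open>lim2\<close>. With \<open>inverse 0 = 0\<close> the
    identity holds for every \<open>n\<close>.\<close>
  have bd_eq: "bd = (\<lambda>n. 4 * K ^ 4 / \<kappa> * inverse (real (n\<^sub>2 n) / M (n\<^sub>1 n) ^ 4)
      + 32 * \<sigma>2 / (r\<^sup>2 * \<kappa>) * (inverse (sqrt (real (n\<^sub>2 n)) * mx n))\<^sup>2)"
    unfolding bd_def by (simp add: fun_eq_iff divide_inverse power_mult_distrib power_inverse algebra_simps)
  have "(\<lambda>n. 4 * K ^ 4 / \<kappa> * inverse (real (n\<^sub>2 n) / M (n\<^sub>1 n) ^ 4)
      + 32 * \<sigma>2 / (r\<^sup>2 * \<kappa>) * (inverse (sqrt (real (n\<^sub>2 n)) * mx n))\<^sup>2)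
      \<longlonglongrightarrow> 4 * K ^ 4 / \<kappa> * 0 + 32 * \<sigma>2 / (r\<^sup>2 * \<kappa>) * 0\<^sup>2"
    using lim4 lim2
    by (intro tendsto_intros tendsto_inverse_0_at_top) (auto simp: mx_def)
  then have "bd \<longlonglongrightarrow> 0" unfolding bd_eq by (simp only: mult_zero_right zero_power2 add_0)
  then have evbd: "\<forall>\<^sub>F n in sequentially. bd n < e" using e(1) by (rule order_tendstoD(2))
  have "\<forall>\<^sub>F m in sequentially. measure (sample_distr {1..m})
      (good_samples \<delta>a \<delta>b m c (r * max (p m) (q m)) (K * M m)) \<ge> 1 - 6 * e"
    using evc evra evrb evKb evK1 evK2 eventually_ge_at_top[of 1]
  proof eventually_elim
    case (elim m)
    show ?case unfolding r_def K_def
      by (rule good_samples_prob_ge[OF proc elim(7) e(1,2) c ra rb Kb pq[OF elim(7)] M[OF elim(7)] elim(1-6)])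
  qed
  \<comment> \<open>The bound holds for all large sample sizes \<open>m\<close>; as
    \<open>n\<^sub>1\<close> tends to infinity, it holds at \<open>m = n\<^sub>1 n\<close> for all
    large \<open>n\<close>.\<close>
  from eventually_compose_filterlim[OF this n1]
  have evG: "\<forall>\<^sub>F n in sequentially. measure (sample_distr {1..n\<^sub>1 n})
      (good_samples \<delta>a \<delta>b (n\<^sub>1 n) c (r * mx n) (K * M (n\<^sub>1 n))) \<ge> 1 - 6 * e"
    by (simp only: mx_def)
  have ev1: "\<forall>\<^sub>F n in sequentially. n\<^sub>1 n \<ge> 1" "\<forall>\<^sub>F n in sequentially. n\<^sub>2 n \<ge> 1"
    using n1 n2 by (auto simp: filterlim_at_top)
  show "\<forall>\<^sub>F n in sequentially. measure (sample_distr {1..n}) (wrong_votes \<delta>a \<delta>b n (n\<^sub>1 n)) < y"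
    using evG evbd ev1 eventually_ge_at_top[of 1]
  proof eventually_elim
    case (elim n)
    have n: "n = n\<^sub>1 n + n\<^sub>2 n" using splitting[OF elim(5)] .
    have lt: "n\<^sub>1 n < n" and sub: "n - n\<^sub>1 n = n\<^sub>2 n" using n elim(4) by linarith+
    have u: "r * mx n > 0" using ra rb pq[OF elim(3)] by (simp add: r_def mx_def)
    have KM: "K * M (n\<^sub>1 n) \<ge> 0" using K1 M[OF elim(3)] by (simp add: K_def)
    have "measure (sample_distr {1..n}) (wrong_votes \<delta>a \<delta>b n (n\<^sub>1 n))
        \<le> (1 - measure (sample_distr {1..n\<^sub>1 n}) (good_samples \<delta>a \<delta>b (n\<^sub>1 n) c (r * mx n) (K * M (n\<^sub>1 n)))) + bd n"
      using wrong_votes_prob[OF proc elim(3) lt c u KM] unfolding sub bd_def \<kappa>_def .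
    then show ?case using elim(1,2) e by linarith
  qed
qed

text \<open>The selection probability is squeezed between 1 and \<open>1\<close> minus twice the
  probability of a wrong vote.\<close>

lemma selection_consistent:
  assumes proc: "regression_procedure \<X> \<delta>\<^sub>1" "regression_procedure \<X> \<delta>\<^sub>2"
    and k: "k = 1 \<and> \<delta>a = \<delta>\<^sub>1 \<and> \<delta>b = \<delta>\<^sub>2 \<or> k = 2 \<and> \<delta>a = \<delta>\<^sub>2 \<and> \<delta>b = \<delta>\<^sub>1"
    and n1: "\<forall>\<^sub>F n in sequentially. n\<^sub>1 n \<ge> 1 \<and> n\<^sub>1 n \<le> n"
    and lim: "(\<lambda>n. measure (sample_distr {1..n}) (wrong_votes \<delta>a \<delta>b n (n\<^sub>1 n))) \<longlonglongrightarrow> 0"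
  shows "(\<lambda>n. prob {w \<in> space \<Omega>. cvv_select n (n\<^sub>1 n) \<delta>\<^sub>1 \<delta>\<^sub>2 (\<lambda>i. (X i w, Y i w)) = k}) \<longlonglongrightarrow> 1"
proof (rule tendsto_sandwich)
  show "\<forall>\<^sub>F n in sequentially. 1 - 2 * measure (sample_distr {1..n}) (wrong_votes \<delta>a \<delta>b n (n\<^sub>1 n))
      \<le> prob {w \<in> space \<Omega>. cvv_select n (n\<^sub>1 n) \<delta>\<^sub>1 \<delta>\<^sub>2 (\<lambda>i. (X i w, Y i w)) = k}"
    using n1 by eventually_elim (rule selection_prob_ge[OF proc _ _ k], auto)
  show "(\<lambda>n. 1 - 2 * measure (sample_distr {1..n}) (wrong_votes \<delta>a \<delta>b n (n\<^sub>1 n))) \<longlonglongrightarrow> 1"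
    using tendsto_diff[OF tendsto_const[of 1] tendsto_mult_left[OF lim, of 2]] by simp
  show "\<forall>\<^sub>F n in sequentially.
      prob {w \<in> space \<Omega>. cvv_select n (n\<^sub>1 n) \<delta>\<^sub>1 \<delta>\<^sub>2 (\<lambda>i. (X i w, Y i w)) = k} \<le> 1"
    by (intro always_eventually allI prob_le_1)
qed (rule tendsto_const)

end

section \<open>Consistency of the voting-based selection\<close>

theorem theorem2:
  fixes \<Omega> :: "'w measure"
    and \<X> :: "(real ^ 'd) set"
    and P\<^sub>X :: "(real ^ 'd) measure"
    and f :: "real ^ 'd \<Rightarrow> real"
    and X :: "nat \<Rightarrow> 'w \<Rightarrow> real ^ 'd"
    and Y \<epsilon> :: "nat \<Rightarrow> 'w \<Rightarrow> real"
    and \<delta>\<^sub>1 \<delta>\<^sub>2 :: "'d procedure"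
    and p q A M :: "nat \<Rightarrow> real"
    and \<sigma>2 :: real
    and n\<^sub>1 n\<^sub>2 :: "nat \<Rightarrow> nat"
  assumes setting: "regression_setting \<Omega> \<X> P\<^sub>X f X Y \<epsilon>"
    and procedures: "regression_procedure \<X> \<delta>\<^sub>1" "regression_procedure \<X> \<delta>\<^sub>2"
    and rate1: "converges_exactly_at_rate \<Omega> (L2_loss P\<^sub>X) f (estimator X Y \<delta>\<^sub>1) p"
    and rate2: "converges_exactly_at_rate \<Omega> (L2_loss P\<^sub>X) f (estimator X Y \<delta>\<^sub>2) q"
    and observations_indep:
      "prob_space.indep_vars \<Omega> (\<lambda>_. obs_space \<X>) (\<lambda>i w. (X i w, Y i w)) {1..}"
    and observations_identically_distributed:
      "\<And>i. i \<ge> 1 \<Longrightarrow> distr \<Omega> (obs_space \<X>) (\<lambda>w. (X i w, Y i w))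
                      = distr \<Omega> (obs_space \<X>) (\<lambda>w. (X 1 w, Y 1 w))"
    and cond0: "\<sigma>2 > 0"
      "\<And>i. i \<ge> 1 \<Longrightarrow> AE w in \<Omega>.
         nn_cond_exp \<Omega> (vimage_algebra (space \<Omega>) (X i) (restrict_space borel \<X>))
           (\<lambda>w. ennreal ((\<epsilon> i w)\<^sup>2)) w \<le> ennreal \<sigma>2"
    and cond1: "\<And>n. n \<ge> 1 \<Longrightarrow> A n > 0"
      "\<And>\<delta>. \<delta> \<in> {\<delta>\<^sub>1, \<delta>\<^sub>2} \<Longrightarrow>
         bigo_prob \<Omega> (\<lambda>n w. Linf_norm P\<^sub>X (\<lambda>x. f x - estimator X Y \<delta> n w x)) A"
    and cond2:
      "asymptotically_better \<Omega> (L2_loss P\<^sub>X) f (estimator X Y \<delta>\<^sub>1) (estimator X Y \<delta>\<^sub>2) \<or>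
       asymptotically_better \<Omega> (L2_loss P\<^sub>X) f (estimator X Y \<delta>\<^sub>2) (estimator X Y \<delta>\<^sub>1)"
    and cond3: "\<And>n. n \<ge> 1 \<Longrightarrow> M n > 0"
      "\<And>\<delta>. \<delta> \<in> {\<delta>\<^sub>1, \<delta>\<^sub>2} \<Longrightarrow>
         bigo_prob \<Omega> (\<lambda>n w. Lq_norm P\<^sub>X 4 (\<lambda>x. f x - estimator X Y \<delta> n w x)
                              / Lq_norm P\<^sub>X 2 (\<lambda>x. f x - estimator X Y \<delta> n w x)) M"
    and splitting: "\<And>n. n \<ge> 1 \<Longrightarrow> n = n\<^sub>1 n + n\<^sub>2 n"
    and cond_a: "filterlim n\<^sub>1 at_top sequentially" "filterlim n\<^sub>2 at_top sequentially"
    and cond_b: "filterlim (\<lambda>n. real (n\<^sub>2 n) / M (n\<^sub>1 n) ^ 4) at_top sequentially"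
    and cond_c: "filterlim (\<lambda>n. sqrt (real (n\<^sub>2 n)) * max (p (n\<^sub>1 n)) (q (n\<^sub>1 n)) / (1 + A (n\<^sub>1 n)))
                   at_top sequentially"
  shows
    "(asymptotically_better \<Omega> (L2_loss P\<^sub>X) f (estimator X Y \<delta>\<^sub>1) (estimator X Y \<delta>\<^sub>2) \<longrightarrow>
        (\<lambda>n. measure \<Omega> {w \<in> space \<Omega>. cvv_select n (n\<^sub>1 n) \<delta>\<^sub>1 \<delta>\<^sub>2 (\<lambda>i. (X i w, Y i w)) = 1})
          \<longlonglongrightarrow> 1) \<and>
     (asymptotically_better \<Omega> (L2_loss P\<^sub>X) f (estimator X Y \<delta>\<^sub>2) (estimator X Y \<delta>\<^sub>1) \<longrightarrow>
        (\<lambda>n. measure \<Omega> {w \<in> space \<Omega>. cvv_select n (n\<^sub>1 n) \<delta>\<^sub>1 \<delta>\<^sub>2 (\<lambda>i. (X i w, Y i w)) = 2})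
          \<longlonglongrightarrow> 1)"
proof -
  interpret regression_setting \<Omega> \<X> P\<^sub>X f X Y \<epsilon> by (rule setting)
  interpret iid_regression \<Omega> \<X> P\<^sub>X f X Y \<epsilon> \<sigma>2
  proof
    show "distr \<Omega> (obs_space \<X>) (\<lambda>w. (X i w, Y i w)) = distr \<Omega> (obs_space \<X>) (\<lambda>w. (X 1 w, Y 1 w))"
      if "i \<ge> 1" for i using that by (rule observations_identically_distributed)
    show "AE w in \<Omega>. nn_cond_exp \<Omega> (vimage_algebra (space \<Omega>) (X 1) (restrict_space borel \<X>))
           (\<lambda>w. ennreal ((\<epsilon> 1 w)\<^sup>2)) w \<le> ennreal \<sigma>2"
      by (rule cond0(2)) simp
  qed (use observations_indep cond0(1) in auto)
  have ev1: "\<forall>\<^sub>F n in sequentially. n\<^sub>1 n \<ge> 1"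
    using cond_a(1) by (auto simp: filterlim_at_top)
  have pq: "p n > 0" "q n > 0" if "n \<ge> 1" for n
    using rate1 rate2 that unfolding converges_exactly_at_rate_def by blast+
  \<comment> \<open>As \<open>A\<close> is positive, division by \<open>1 + A\<close> only decreases
    the product, so the undivided product tends to infinity as well.\<close>
  have lim: "filterlim (\<lambda>n. sqrt (real (n\<^sub>2 n)) * max (p (n\<^sub>1 n)) (q (n\<^sub>1 n))) at_top sequentially"
  proof (rule filterlim_at_top_mono[OF cond_c])
    show "\<forall>\<^sub>F n in sequentially. sqrt (real (n\<^sub>2 n)) * max (p (n\<^sub>1 n)) (q (n\<^sub>1 n)) / (1 + A (n\<^sub>1 n))
        \<le> sqrt (real (n\<^sub>2 n)) * max (p (n\<^sub>1 n)) (q (n\<^sub>1 n))"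
      using ev1
    proof eventually_elim
      case (elim n)
      have "0 \<le> sqrt (real (n\<^sub>2 n)) * max (p (n\<^sub>1 n)) (q (n\<^sub>1 n))"
        using pq[OF elim] by (intro mult_nonneg_nonneg) auto
      from divide_left_mono[OF _ this, of 1 "1 + A (n\<^sub>1 n)"] show ?case
        using cond1(1)[OF elim] by simp
    qed
  qed
  have le: "\<forall>\<^sub>F n in sequentially. n\<^sub>1 n \<ge> 1 \<and> n\<^sub>1 n \<le> n"
    using ev1 eventually_ge_at_top[of 1]
  proof eventually_elim
    case (elim n)
    then show ?case using splitting[OF elim(2)] by linarith
  qed
  show ?thesis
  proof (intro conjI impI)
    assume "asymptotically_better \<Omega> (L2_loss P\<^sub>X) f (estimator X Y \<delta>\<^sub>1) (estimator X Y \<delta>\<^sub>2)"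
    from wrong_votes_prob_tendsto_0[OF procedures rate1 rate2 this cond3 splitting cond_a cond_b lim]
    show "(\<lambda>n. measure \<Omega> {w \<in> space \<Omega>. cvv_select n (n\<^sub>1 n) \<delta>\<^sub>1 \<delta>\<^sub>2 (\<lambda>i. (X i w, Y i w)) = 1}) \<longlonglongrightarrow> 1"
      by (intro selection_consistent[OF procedures _ le]) auto
  next
    assume b: "asymptotically_better \<Omega> (L2_loss P\<^sub>X) f (estimator X Y \<delta>\<^sub>2) (estimator X Y \<delta>\<^sub>1)"
    \<comment> \<open>Exchanging the roles of the procedures exchanges the rates, and the maximum of
      the rates is symmetric.\<close>
    have "(\<lambda>n. measure (sample_distr {1..n}) (wrong_votes \<delta>\<^sub>2 \<delta>\<^sub>1 n (n\<^sub>1 n))) \<longlonglongrightarrow> 0"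
    proof (rule wrong_votes_prob_tendsto_0[OF procedures(2,1) rate2 rate1 b cond3(1) _ splitting cond_a cond_b])
      show "filterlim (\<lambda>n. sqrt (real (n\<^sub>2 n)) * max (q (n\<^sub>1 n)) (p (n\<^sub>1 n))) at_top sequentially"
        using lim by (simp only: max.commute)
    qed (use cond3(2) in auto)
    then show "(\<lambda>n. measure \<Omega> {w \<in> space \<Omega>. cvv_select n (n\<^sub>1 n) \<delta>\<^sub>1 \<delta>\<^sub>2 (\<lambda>i. (X i w, Y i w)) = 2}) \<longlonglongrightarrow> 1"
      by (intro selection_consistent[OF procedures _ le]) auto
  qed
qed

end
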